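(* Let $t\colon G\to H$, $\alpha\colon H\to\operatorname{Aut}(G)$ be a crossed module of topological groups, let $G_1=\ker t$, and let $M$ be a space. Let $\pi_0\mathbf{Bun}_{G_1}(M)$ be the set of isomorphism classes of principal $G_1$-bundles on $M$, pointed by the class of the trivial bundle, let $\pi_0\mathbf{Bibun}_{(H,G)}(M)$ be the set of isomorphism classes of $(H,G)$ bibundles on $M$, pointed by the class of the trivial bibundle, and let $\operatorname{Map}(M,H/t(G))$ be the set of continuous maps $M\to H/t(G)$, pointed by the constant map $1$. Then the sequence $$1\to \pi_0\mathbf{Bun}_{G_1}(M)\stackrel{\iota}{\longrightarrow}\pi_0\mathbf{Bibun}_{(H,G)}(M)\stackrel{\operatorname{Type}}{\longrightarrow}\operatorname{Map}(M,H/t(G))$$ is an exact sequence of pointed sets; that is, for a $G_1$-bundle $Q$, $\iota(Q)$ is a trivial bibundle only if $Q$ is trivial, and for an $(H,G)$ bibundle $P$ on $M$, $\operatorname{Type}(P)=1$ if and only if $P\cong\iota(R)$ for some principal $G_1$-bundle $R$ on $M$. In particular, for the crossed module $\operatorname{Ad}\colon G\to\operatorname{Aut}(G)$ one obtains the exact sequence of pointed sets $\pi_0\mathbf{Bun}_{Z(G)}(M)\to\pi_0\mathbf{Bibun}_{G}(M)\to\operatorname{Map}(M,\operatorname{Out}(G))$.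
   Context: A crossed module $(H,G)$ consists of topological groups $G,H$ and homomorphisms $t\colon G\to H$ (continuous) and $\alpha\colon H\to\operatorname{Aut}(G)$ (giving a continuous action of $H$ on $G$) with $t(\alpha(h)(g))=h\,t(g)\,h^{-1}$ and $\alpha(t(g))(g')=gg'g^{-1}$. Then $G_1=\ker t$ is central in $G$ and $t(G)$ is normal in $H$. Standing assumptions: the projections $G\to G/G_1$ and $H\to H/t(G)$ admit local sections, and $t(G)$ is identified with $G/G_1$ as a topological group. An $(H,G)$ bibundle on $M$ is a (locally trivial, right) principal $G$-bundle $P\to M$ with a continuous structure map $\psi\colon P\to H$ satisfying $\psi(pg)=\psi(p)t(g)$. An isomorphism of bibundles on $M$ is an isomorphism of principal $G$-bundles over the identity of $M$ commuting with structure maps. The type map $\operatorname{Type}(P)\colon M\to H/t(G)$ sends $m$ to the coset $[\psi(p)]$ for any $p\in P_m$; it is continuous and depends only on the isomorphism class of $P$. The trivial bibundle is $M\times G$ with structure map $(m,g)\mapsto t(g)$; a bibundle is trivial if it is isomorphic to this one. For a principal $G_1$-bundle $Q\to M$, $\iota(Q)=Q\times_{G_1}G$ (the quotient of $Q\times G$ by $(q,g)\sim(qa,a^{-1}g)$, $a\in G_1$), with right $G$-action $[q,g]g'=[q,gg']$ and structure map $\psi([q,g])=t(g)$. For $H=\operatorname{Aut}(G)$, $t=\operatorname{Ad}$, $\alpha=\mathrm{id}$, an $(\operatorname{Aut}(G),G)$ bibundle is called a $G$ bibundle, $\mathbf{Bibun}_G=\mathbf{Bibun}_{(\operatorname{Aut}(G),G)}$,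 $G_1=Z(G)$ and $H/t(G)=\operatorname{Out}(G)$. *)

theory Defs
  imports "HOL-Algebra.Coset" "HOL-Algebra.Bij" "HOL-Analysis.Product_Topology"
begin

section \<open>Topological preliminaries\<close>

definition quotient_topology :: "'a topology \<Rightarrow> ('a \<Rightarrow> 'b) \<Rightarrow> 'b topology" where
  "quotient_topology X f =
     topology (\<lambda>V. V \<subseteq> f ` topspace X \<and> openin X {x \<in> topspace X. f x \<in> V})"

lemma openin_quotient_topology:
  "openin (quotient_topology X f) V \<longleftrightarrow>
     V \<subseteq> f ` topspace X \<and> openin X {x \<in> topspace X. f x \<in> V}"
proof -
  have "istopology (\<lambda>V. V \<subseteq> f ` topspace X \<and> openin X {x \<in> topspace X. f x \<in> V})"
    unfolding istopology_def
  proof (intro conjI allI impI)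
    fix S T
    assume S: "S \<subseteq> f ` topspace X \<and> openin X {x \<in> topspace X. f x \<in> S}"
      and T: "T \<subseteq> f ` topspace X \<and> openin X {x \<in> topspace X. f x \<in> T}"
    show "S \<inter> T \<subseteq> f ` topspace X" using S by auto
    have "{x \<in> topspace X. f x \<in> S \<inter> T} = {x \<in> topspace X. f x \<in> S} \<inter> {x \<in> topspace X. f x \<in> T}"
      by auto
    then show "openin X {x \<in> topspace X. f x \<in> S \<inter> T}" using S T by auto
  next
    fix \<K> assume K: "\<forall>K\<in>\<K>. K \<subseteq> f ` topspace X \<and> openin X {x \<in> topspace X. f x \<in> K}"
    show "\<Union>\<K> \<subseteq> f ` topspace X" using K by auto
    have "{x \<in> topspace X. f x \<in> \<Union>\<K>} = (\<Union>K\<in>\<K>. {x \<in> topspace X. f x \<in> K})" by auto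
    then show "openin X {x \<in> topspace X. f x \<in> \<Union>\<K>}" using K by auto
  qed
  then show ?thesis by (simp add: quotient_topology_def)
qed

lemma topspace_quotient_topology [simp]: "topspace (quotient_topology X f) = f ` topspace X"
proof -
  have "{x \<in> topspace X. f x \<in> f ` topspace X} = topspace X" by auto
  then have "openin (quotient_topology X f) (f ` topspace X)"
    by (simp add: openin_quotient_topology)
  then have "f ` topspace X \<subseteq> topspace (quotient_topology X f)"
    by (rule openin_subset)
  moreover have "topspace (quotient_topology X f) \<subseteq> f ` topspace X"
    using openin_topspace[of "quotient_topology X f"] unfolding openin_quotient_topology by blast
  ultimately show ?thesis by blast
qed

lemma quotient_map_quotient_topology: "quotient_map X (quotient_topology X f) f"
  by (simp add: quotient_map_def openin_quotient_topology)

definition has_local_sections :: "'a topology \<Rightarrow> 'b topology \<Rightarrow> ('a \<Rightarrow> 'b) \<Rightarrow> bool" where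
  "has_local_sections X Y p \<longleftrightarrow>
     (\<forall>y \<in> topspace Y. \<exists>U s. openin Y U \<and> y \<in> U \<and>
        continuous_map (subtopology Y U) X s \<and> (\<forall>u\<in>U. p (s u) = u))"


section \<open>Topological groups and crossed modules\<close>

locale topological_group = group G for G (structure) +
  fixes T :: "'a topology"
  assumes topspace_eq: "topspace T = carrier G"
    and continuous_mult: "continuous_map (prod_topology T T) T (\<lambda>(x, y). x \<otimes> y)"
    and continuous_inv: "continuous_map T T (\<lambda>x. inv x)"

text \<open>Automorphisms of a topological group are homeomorphisms.  As in the library's
  \<^const>\<open>AutoGroup\<close>, they are extensional functions on the carrier.\<close>

definition TopAut :: "('a, 'b) monoid_scheme \<Rightarrow> 'a topology \<Rightarrow> ('a \<Rightarrow> 'a) monoid" where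
  "TopAut G T = (AutoGroup G)\<lparr>carrier := {f \<in> auto G. homeomorphic_map T T f}\<rparr>"

locale crossed_module =
  G: topological_group G TG + H: topological_group H TH
  for G (structure) and TG :: "'g topology" and H (structure) and TH :: "'h topology"
    and t :: "'g \<Rightarrow> 'h" and \<alpha> :: "'h \<Rightarrow> 'g \<Rightarrow> 'g" +
  assumes t_hom: "t \<in> hom G H"
    and t_continuous: "continuous_map TG TH t"
    and action_hom: "\<alpha> \<in> hom H (TopAut G TG)"
    and action_continuous: "continuous_map (prod_topology TH TG) TG (\<lambda>(h, g). \<alpha> h g)"
    and equivariant: "\<And>h g. h \<in> carrier H \<Longrightarrow> g \<in> carrier G \<Longrightarrow>
               t (\<alpha> h g) = h \<otimes>\<^bsub>H\<^esub> t g \<otimes>\<^bsub>H\<^esub> inv\<^bsub>H\<^esub> h"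
    and peiffer: "\<And>g g'. g \<in> carrier G \<Longrightarrow> g' \<in> carrier G \<Longrightarrow>
               \<alpha> (t g) g' = g \<otimes>\<^bsub>G\<^esub> g' \<otimes>\<^bsub>G\<^esub> inv\<^bsub>G\<^esub> g"

text \<open>For a normal subgroup \<open>N\<close> the projection onto \<open>G Mod N\<close> is \<open>g \<mapsto> N #> g\<close>
  (left and right cosets coincide).\<close>

definition coset_topology ::
    "('a, 'b) monoid_scheme \<Rightarrow> 'a topology \<Rightarrow> 'a set \<Rightarrow> 'a set topology" where
  "coset_topology G T N = quotient_topology T (\<lambda>g. N #>\<^bsub>G\<^esub> g)"

text \<open>The last assumption says that the canonical bijection from \<open>G Mod kernel G H t\<close> to
  \<open>t ` carrier G\<close> (cf. \<open>group_hom.FactGroup_iso_set\<close>) is a homeomorphism, where the image carries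
  the subspace topology from \<open>H\<close>.\<close>

locale admissible_crossed_module = crossed_module G TG H TH t \<alpha>
  for G (structure) and TG :: "'g topology" and H (structure) and TH :: "'h topology"
    and t :: "'g \<Rightarrow> 'h" and \<alpha> :: "'h \<Rightarrow> 'g \<Rightarrow> 'g" +
  assumes local_sections_G:
      "has_local_sections TG (coset_topology G TG (kernel G H t)) (\<lambda>g. kernel G H t #>\<^bsub>G\<^esub> g)"
    and local_sections_H:
      "has_local_sections TH (coset_topology H TH (t ` carrier G)) (\<lambda>h. (t ` carrier G) #>\<^bsub>H\<^esub> h)"
    and image_homeomorphic:
      "homeomorphic_map (coset_topology G TG (kernel G H t)) (subtopology TH (t ` carrier G))
         (\<lambda>C. the_elem (t ` C))"


section \<open>Principal bundles and bibundles\<close>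

record ('p, 'm, 'g) pbundle =
  total :: "'p topology"
  bproj :: "'p \<Rightarrow> 'm"
  ract :: "'p \<Rightarrow> 'g \<Rightarrow> 'p"

record ('p, 'm, 'g, 'h) bibundle = "('p, 'm, 'g) pbundle" +
  str :: "'p \<Rightarrow> 'h"

definition principal_bundle ::
    "('g, 'b) monoid_scheme \<Rightarrow> 'g topology \<Rightarrow> 'm topology \<Rightarrow> ('p, 'm, 'g, 'z) pbundle_scheme \<Rightarrow> bool"
where
  "principal_bundle G TG M P \<longleftrightarrow>
     continuous_map (total P) M (bproj P) \<and>
     continuous_map (prod_topology (total P) TG) (total P) (\<lambda>(p, g). ract P p g) \<and>
     (\<forall>p \<in> topspace (total P). ract P p \<one>\<^bsub>G\<^esub> = p) \<and>
     (\<forall>p \<in> topspace (total P). \<forall>g \<in> carrier G. \<forall>g' \<in> carrier G.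
        ract P (ract P p g) g' = ract P p (g \<otimes>\<^bsub>G\<^esub> g')) \<and>
     (\<forall>p \<in> topspace (total P). \<forall>g \<in> carrier G. bproj P (ract P p g) = bproj P p) \<and>
     (\<forall>m \<in> topspace M. \<exists>U \<phi>. openin M U \<and> m \<in> U \<and>
        homeomorphic_map (prod_topology (subtopology M U) TG)
          (subtopology (total P) {p \<in> topspace (total P). bproj P p \<in> U}) \<phi> \<and>
        (\<forall>u \<in> U. \<forall>g \<in> carrier G. bproj P (\<phi> (u, g)) = u) \<and>
        (\<forall>u \<in> U. \<forall>g \<in> carrier G. \<forall>g' \<in> carrier G.
           \<phi> (u, g \<otimes>\<^bsub>G\<^esub> g') = ract P (\<phi> (u, g)) g'))"

definition bibundle ::
    "('g, 'b) monoid_scheme \<Rightarrow> 'g topology \<Rightarrow> ('h, 'c) monoid_scheme \<Rightarrow> 'h topology \<Rightarrow> ('g \<Rightarrow> 'h) \<Rightarrow>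
     'm topology \<Rightarrow> ('p, 'm, 'g, 'h) bibundle \<Rightarrow> bool" where
  "bibundle G TG H TH t M P \<longleftrightarrow>
     principal_bundle G TG M P \<and>
     continuous_map (total P) TH (str P) \<and>
     (\<forall>p \<in> topspace (total P). \<forall>g \<in> carrier G. str P (ract P p g) = str P p \<otimes>\<^bsub>H\<^esub> t g)"

definition bundle_iso ::
    "('g, 'b) monoid_scheme \<Rightarrow> ('p, 'm, 'g, 'z) pbundle_scheme \<Rightarrow> ('q, 'm, 'g, 'w) pbundle_scheme \<Rightarrow>
     ('p \<Rightarrow> 'q) \<Rightarrow> bool" where
  "bundle_iso G P Q \<phi> \<longleftrightarrow>
     homeomorphic_map (total P) (total Q) \<phi> \<and>
     (\<forall>p \<in> topspace (total P). bproj Q (\<phi> p) = bproj P p) \<and>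
     (\<forall>p \<in> topspace (total P). \<forall>g \<in> carrier G. \<phi> (ract P p g) = ract Q (\<phi> p) g)"

definition bundle_isomorphic ::
    "('g, 'b) monoid_scheme \<Rightarrow> ('p, 'm, 'g, 'z) pbundle_scheme \<Rightarrow> ('q, 'm, 'g, 'w) pbundle_scheme \<Rightarrow> bool"
where
  "bundle_isomorphic G P Q \<longleftrightarrow> (\<exists>\<phi>. bundle_iso G P Q \<phi>)"

definition bibundle_isomorphic ::
    "('g, 'b) monoid_scheme \<Rightarrow> ('p, 'm, 'g, 'h) bibundle \<Rightarrow> ('q, 'm, 'g, 'h) bibundle \<Rightarrow> bool" where
  "bibundle_isomorphic G P Q \<longleftrightarrow>
     (\<exists>\<phi>. bundle_iso G P Q \<phi> \<and> (\<forall>p \<in> topspace (total P). str Q (\<phi> p) = str P p))"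

definition trivial_bundle ::
    "('g, 'b) monoid_scheme \<Rightarrow> 'g topology \<Rightarrow> 'm topology \<Rightarrow> ('m \<times> 'g, 'm, 'g) pbundle" where
  "trivial_bundle G TG M =
     \<lparr>total = prod_topology M TG, bproj = fst, ract = (\<lambda>(m, g) g'. (m, g \<otimes>\<^bsub>G\<^esub> g'))\<rparr>"

definition trivial_bibundle ::
    "('g, 'b) monoid_scheme \<Rightarrow> 'g topology \<Rightarrow> ('g \<Rightarrow> 'h) \<Rightarrow> 'm topology \<Rightarrow>
     ('m \<times> 'g, 'm, 'g, 'h) bibundle" where
  "trivial_bibundle G TG t M =
     \<lparr>total = prod_topology M TG, bproj = fst, ract = (\<lambda>(m, g) g'. (m, g \<otimes>\<^bsub>G\<^esub> g')),
      str = (\<lambda>(m, g). t g)\<rparr>"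

text \<open>\<open>Type P m\<close> is the coset of \<open>\<psi>(p)\<close>, the same for all \<open>p\<close> in the fibre over \<open>m\<close>.\<close>

definition type_map ::
    "('g, 'b) monoid_scheme \<Rightarrow> ('h, 'c) monoid_scheme \<Rightarrow> ('g \<Rightarrow> 'h) \<Rightarrow> 'm topology \<Rightarrow>
     ('p, 'm, 'g, 'h) bibundle \<Rightarrow> 'm \<Rightarrow> 'h set" where
  "type_map G H t M P =
     (\<lambda>m \<in> topspace M. the_elem
        ((\<lambda>p. (t ` carrier G) #>\<^bsub>H\<^esub> str P p) ` {p \<in> topspace (total P). bproj P p = m}))"


section \<open>Every bundle has a copy with total space of type \<open>'m \<times> 'g\<close>\<close>

lemma principal_bundle_transitive:
  assumes "group G" "topspace TG = carrier G" and P: "principal_bundle G TG M P"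
    and p: "p \<in> topspace (total P)" and p': "p' \<in> topspace (total P)"
    and eq: "bproj P p = bproj P p'"
  shows "\<exists>g \<in> carrier G. ract P p g = p'"
proof -
  interpret group G by fact
  define m where "m = bproj P p"
  have cont: "continuous_map (total P) M (bproj P)"
    using P[unfolded principal_bundle_def, THEN conjunct1] .
  have m: "m \<in> topspace M"
    using cont p by (auto simp: m_def continuous_map_def Pi_iff)
  have "\<forall>m \<in> topspace M. \<exists>U \<phi>. openin M U \<and> m \<in> U \<and>
        homeomorphic_map (prod_topology (subtopology M U) TG)
          (subtopology (total P) {p \<in> topspace (total P). bproj P p \<in> U}) \<phi> \<and>
        (\<forall>u \<in> U. \<forall>g \<in> carrier G. bproj P (\<phi> (u, g)) = u) \<and>
        (\<forall>u \<in> U. \<forall>g \<in> carrier G. \<forall>g' \<in> carrier G.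
           \<phi> (u, g \<otimes>\<^bsub>G\<^esub> g') = ract P (\<phi> (u, g)) g')"
    using P[unfolded principal_bundle_def, THEN conjunct2, THEN conjunct2, THEN conjunct2, THEN conjunct2, THEN conjunct2] .
  from this[THEN bspec, OF m] obtain U \<phi> where U: "openin M U" "m \<in> U"
    and h: "homeomorphic_map (prod_topology (subtopology M U) TG)
          (subtopology (total P) {p \<in> topspace (total P). bproj P p \<in> U}) \<phi>"
    and pr: "\<forall>u \<in> U. \<forall>g \<in> carrier G. bproj P (\<phi> (u, g)) = u"
    and ac: "\<forall>u \<in> U. \<forall>g \<in> carrier G. \<forall>g' \<in> carrier G.
           \<phi> (u, g \<otimes>\<^bsub>G\<^esub> g') = ract P (\<phi> (u, g)) g'"
    by (elim exE conjE) (rule that)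
  have UM: "U \<subseteq> topspace M" using U openin_subset by blast
  have surj: "\<phi> ` (U \<times> carrier G) = {p \<in> topspace (total P). bproj P p \<in> U}"
  proof -
    have "topspace (prod_topology (subtopology M U) TG) = U \<times> carrier G"
      using UM assms(2) by auto
    moreover have "topspace (subtopology (total P) {p \<in> topspace (total P). bproj P p \<in> U}) =
        {p \<in> topspace (total P). bproj P p \<in> U}"
      by auto
    ultimately show ?thesis using homeomorphic_imp_surjective_map[OF h] by simp
  qed
  have "p \<in> \<phi> ` (U \<times> carrier G)" "p' \<in> \<phi> ` (U \<times> carrier G)"
    unfolding surj using p p' eq U m_def by auto
  then obtain u g u' g' where *: "u \<in> U" "g \<in> carrier G" "p = \<phi> (u, g)"
      "u' \<in> U" "g' \<in> carrier G" "p' = \<phi> (u', g')" by auto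
  then have "u = u'" using pr eq by metis
  have "ract P p (inv\<^bsub>G\<^esub> g \<otimes>\<^bsub>G\<^esub> g') = \<phi> (u, g \<otimes>\<^bsub>G\<^esub> (inv\<^bsub>G\<^esub> g \<otimes>\<^bsub>G\<^esub> g'))"
    using * ac by auto
  also have "g \<otimes>\<^bsub>G\<^esub> (inv\<^bsub>G\<^esub> g \<otimes>\<^bsub>G\<^esub> g') = g'"
    using * by (metis inv_closed l_one m_assoc r_inv)
  finally show ?thesis using * \<open>u = u'\<close> by (intro bexI[of _ "inv\<^bsub>G\<^esub> g \<otimes>\<^bsub>G\<^esub> g'"]) auto
qed

lemma principal_bundle_transport:
  fixes P :: "('p, 'm, 'g, 'z) pbundle_scheme" and P' :: "('q, 'm, 'g, 'w) pbundle_scheme"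
  assumes top: "topspace TG = carrier G"
    and mult: "\<And>g g'. g \<in> carrier G \<Longrightarrow> g' \<in> carrier G \<Longrightarrow> g \<otimes>\<^bsub>G\<^esub> g' \<in> carrier G"
    and P: "principal_bundle G TG M P"
    and hom: "homeomorphic_maps (total P) (total P') e d"
    and proj': "\<And>x. bproj P' x = bproj P (d x)"
    and act': "\<And>x g. ract P' x g = e (ract P (d x) g)"
  shows "principal_bundle G TG M P'"
proof -
  have e: "continuous_map (total P) (total P') e" and d: "continuous_map (total P') (total P) d"
    and de: "\<And>p. p \<in> topspace (total P) \<Longrightarrow> d (e p) = p"
    and ed: "\<And>x. x \<in> topspace (total P') \<Longrightarrow> e (d x) = x"
    using hom unfolding homeomorphic_maps_def by auto
  have eS: "\<And>p. p \<in> topspace (total P) \<Longrightarrow> e p \<in> topspace (total P')"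
    and dS: "\<And>x. x \<in> topspace (total P') \<Longrightarrow> d x \<in> topspace (total P)"
    using e d by (auto simp: continuous_map_def Pi_iff)
  have c1: "continuous_map (total P) M (bproj P)"
    by (rule P[unfolded principal_bundle_def, THEN conjunct1])
  have c2: "continuous_map (prod_topology (total P) TG) (total P) (\<lambda>(p, g). ract P p g)"
    by (rule P[unfolded principal_bundle_def, THEN conjunct2, THEN conjunct1])
  have one: "\<And>p. p \<in> topspace (total P) \<Longrightarrow> ract P p \<one>\<^bsub>G\<^esub> = p"
    by (rule P[unfolded principal_bundle_def, THEN conjunct2, THEN conjunct2, THEN conjunct1, rule_format])
  have assoc: "\<And>p g g'. p \<in> topspace (total P) \<Longrightarrow> g \<in> carrier G \<Longrightarrow> g' \<in> carrier G \<Longrightarrow>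
        ract P (ract P p g) g' = ract P p (g \<otimes>\<^bsub>G\<^esub> g')"
    by (rule P[unfolded principal_bundle_def, THEN conjunct2, THEN conjunct2, THEN conjunct2, THEN conjunct1, rule_format])
  have fib: "\<And>p g. p \<in> topspace (total P) \<Longrightarrow> g \<in> carrier G \<Longrightarrow> bproj P (ract P p g) = bproj P p"
    by (rule P[unfolded principal_bundle_def, THEN conjunct2, THEN conjunct2, THEN conjunct2, THEN conjunct2, THEN conjunct1, rule_format])
  have triv: "\<And>m. m \<in> topspace M \<Longrightarrow> \<exists>U \<phi>. openin M U \<and> m \<in> U \<and>
        homeomorphic_map (prod_topology (subtopology M U) TG)
          (subtopology (total P) {p \<in> topspace (total P). bproj P p \<in> U}) \<phi> \<and>
        (\<forall>u \<in> U. \<forall>g \<in> carrier G. bproj P (\<phi> (u, g)) = u) \<and>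
        (\<forall>u \<in> U. \<forall>g \<in> carrier G. \<forall>g' \<in> carrier G.
           \<phi> (u, g \<otimes>\<^bsub>G\<^esub> g') = ract P (\<phi> (u, g)) g')"
    by (rule P[unfolded principal_bundle_def, THEN conjunct2, THEN conjunct2, THEN conjunct2, THEN conjunct2, THEN conjunct2, THEN bspec])
  have actS: "ract P p g \<in> topspace (total P)" if "p \<in> topspace (total P)" "g \<in> carrier G" for p g
    using c2 that top by (auto simp: continuous_map_def Pi_iff)
  show ?thesis
    unfolding principal_bundle_def
  proof (intro conjI ballI)
    show "continuous_map (total P') M (bproj P')"
    proof -
      have "bproj P' = bproj P \<circ> d" by (simp add: proj' fun_eq_iff)
      then show ?thesis using continuous_map_compose[OF d c1] by simp
    qed
    have "continuous_map (prod_topology (total P') TG) (prod_topology (total P) TG) (\<lambda>(x, g). (d x, g))"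
      using continuous_map_prod_top[of "total P'" TG "total P" TG d "\<lambda>g. g"] d by simp
    from continuous_map_compose[OF continuous_map_compose[OF this c2] e]
    show "continuous_map (prod_topology (total P') TG) (total P') (\<lambda>(p, g). ract P' p g)"
      by (simp add: act' comp_def case_prod_unfold)
  next
    fix x assume "x \<in> topspace (total P')"
    then show "ract P' x \<one>\<^bsub>G\<^esub> = x" by (simp add: act' one dS ed)
  next
    fix x g g' assume "x \<in> topspace (total P')" "g \<in> carrier G" "g' \<in> carrier G"
    then show "ract P' (ract P' x g) g' = ract P' x (g \<otimes>\<^bsub>G\<^esub> g')"
      by (simp add: act' dS de actS assoc)
  next
    fix x g assume "x \<in> topspace (total P')" "g \<in> carrier G"
    then show "bproj P' (ract P' x g) = bproj P' x" by (simp add: act' proj' dS de actS fib)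
  next
    fix m assume "m \<in> topspace M"
    from triv[OF this] obtain U \<phi> where U: "openin M U" "m \<in> U"
      and h: "homeomorphic_map (prod_topology (subtopology M U) TG)
          (subtopology (total P) {p \<in> topspace (total P). bproj P p \<in> U}) \<phi>"
      and pr: "\<forall>u \<in> U. \<forall>g \<in> carrier G. bproj P (\<phi> (u, g)) = u"
      and ac: "\<forall>u \<in> U. \<forall>g \<in> carrier G. \<forall>g' \<in> carrier G.
           \<phi> (u, g \<otimes>\<^bsub>G\<^esub> g') = ract P (\<phi> (u, g)) g'"
      by (elim exE conjE) (rule that)
    let ?A = "{p \<in> topspace (total P). bproj P p \<in> U}"
    let ?B = "{p \<in> topspace (total P'). bproj P' p \<in> U}"
    have "e ` (topspace (total P) \<inter> ?A) = topspace (total P') \<inter> ?B"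
    proof (intro subset_antisym subsetI)
      fix y assume "y \<in> e ` (topspace (total P) \<inter> ?A)"
      then show "y \<in> topspace (total P') \<inter> ?B" by (auto simp: eS proj' de)
    next
      fix y assume "y \<in> topspace (total P') \<inter> ?B"
      then have "y = e (d y)" "d y \<in> topspace (total P) \<inter> ?A" by (auto simp: ed proj' dS)
      then show "y \<in> e ` (topspace (total P) \<inter> ?A)" by (rule image_eqI)
    qed
    with hom have "homeomorphic_maps (subtopology (total P) ?A) (subtopology (total P') ?B) e d"
      by (rule homeomorphic_maps_subtopologies)
    then have h': "homeomorphic_map (prod_topology (subtopology M U) TG) (subtopology (total P') ?B) (e \<circ> \<phi>)"
      using h homeomorphic_map_compose homeomorphic_maps_imp_map by blast
    have \<phi>S: "\<phi> (u, g) \<in> topspace (total P)" if "u \<in> U" "g \<in> carrier G" for u g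
    proof -
      have "u \<in> topspace M" using U that openin_subset by blast
      then have "(u, g) \<in> topspace (prod_topology (subtopology M U) TG)"
        using that top by simp
      then show ?thesis using homeomorphic_imp_surjective_map[OF h] by auto
    qed
    show "\<exists>U \<phi>. openin M U \<and> m \<in> U \<and>
        homeomorphic_map (prod_topology (subtopology M U) TG)
          (subtopology (total P') {p \<in> topspace (total P'). bproj P' p \<in> U}) \<phi> \<and>
        (\<forall>u \<in> U. \<forall>g \<in> carrier G. bproj P' (\<phi> (u, g)) = u) \<and>
        (\<forall>u \<in> U. \<forall>g \<in> carrier G. \<forall>g' \<in> carrier G.
           \<phi> (u, g \<otimes>\<^bsub>G\<^esub> g') = ract P' (\<phi> (u, g)) g')"
      using U h' pr ac \<phi>S by (intro exI[of _ U] exI[of _ "e \<circ> \<phi>"]) (auto simp: proj' act' de)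
  qed
qed

lemma homeomorphic_copy:
  fixes P :: "('p, 'm, 'g, 'z) pbundle_scheme"
  assumes "group G" "topspace TG = carrier G" and P: "principal_bundle G TG M P"
  shows "\<exists>(X :: ('m \<times> 'g) topology) e d. homeomorphic_maps (total P) X e d"
proof -
  define S where "S = topspace (total P)"
  define b where "b = (\<lambda>m. SOME q. q \<in> S \<and> bproj P q = m)"
  define \<gamma> where "\<gamma> = (\<lambda>p. SOME g. g \<in> carrier G \<and> ract P (b (bproj P p)) g = p)"
  define e where "e = (\<lambda>p. (bproj P p, \<gamma> p))"
  have \<gamma>: "ract P (b (bproj P p)) (\<gamma> p) = p" if "p \<in> S" for p
  proof -
    have "b (bproj P p) \<in> S \<and> bproj P (b (bproj P p)) = bproj P p"
      unfolding b_def by (rule someI_ex) (use that in auto)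
    then have "\<exists>g. g \<in> carrier G \<and> ract P (b (bproj P p)) g = p"
      using principal_bundle_transitive[OF assms] that unfolding S_def by blast
    then show ?thesis unfolding \<gamma>_def by (rule someI2_ex) auto
  qed
  have "inj_on e S"
    by (rule inj_onI) (metis \<gamma> e_def fst_conv snd_conv)
  then have "homeomorphic_map (total P) (quotient_topology (total P) e) e"
    unfolding homeomorphic_map_def S_def by (simp add: quotient_map_quotient_topology)
  then show ?thesis unfolding homeomorphic_map_maps by blast
qed

lemma bundle_representable:
  fixes P :: "('p, 'm, 'g) pbundle"
  assumes "group G" "topspace TG = carrier G" and P: "principal_bundle G TG M P"
  shows "\<exists>P' :: ('m \<times> 'g, 'm, 'g) pbundle. principal_bundle G TG M P' \<and> bundle_isomorphic G P P'"
proof -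
  obtain X :: "('m \<times> 'g) topology" and e d where hom: "homeomorphic_maps (total P) X e d"
    using homeomorphic_copy[OF assms] by blast
  define P' :: "('m \<times> 'g, 'm, 'g) pbundle" where
    "P' = \<lparr>total = X, bproj = (\<lambda>x. bproj P (d x)), ract = (\<lambda>x g. e (ract P (d x) g))\<rparr>"
  have "principal_bundle G TG M P'"
    by (rule principal_bundle_transport[OF assms(2) _ P, of P' e d])
      (use assms(1) hom in \<open>auto simp: P'_def group.is_monoid monoid.m_closed\<close>)
  moreover have "bundle_iso G P P' e"
    using hom homeomorphic_maps_imp_map[OF hom]
    unfolding bundle_iso_def homeomorphic_maps_def by (simp add: P'_def)
  ultimately show ?thesis unfolding bundle_isomorphic_def by blast
qed

lemma bibundle_representable:
  fixes P :: "('p, 'm, 'g, 'h) bibundle"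
  assumes "group G" "topspace TG = carrier G" and P: "bibundle G TG H TH t M P"
  shows "\<exists>P' :: ('m \<times> 'g, 'm, 'g, 'h) bibundle.
           bibundle G TG H TH t M P' \<and> bibundle_isomorphic G P P'"
proof -
  have prin: "principal_bundle G TG M P" using P by (simp add: bibundle_def)
  obtain X :: "('m \<times> 'g) topology" and e d where hom: "homeomorphic_maps (total P) X e d"
    using homeomorphic_copy[OF assms(1,2) prin] by blast
  then have d: "continuous_map X (total P) d" and de: "\<forall>p \<in> topspace (total P). d (e p) = p"
    by (auto simp: homeomorphic_maps_def)
  have dS: "d x \<in> topspace (total P)" if "x \<in> topspace X" for x
    using d that by (auto simp: continuous_map_def Pi_iff)
  have actS: "ract P p g \<in> topspace (total P)" if "p \<in> topspace (total P)" "g \<in> carrier G" for p g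
  proof -
    have "continuous_map (prod_topology (total P) TG) (total P) (\<lambda>(p, g). ract P p g)"
      using prin[unfolded principal_bundle_def, THEN conjunct2, THEN conjunct1] .
    then show ?thesis using that assms(2) by (auto simp: continuous_map_def Pi_iff)
  qed
  define P' :: "('m \<times> 'g, 'm, 'g, 'h) bibundle" where
    "P' = \<lparr>total = X, bproj = (\<lambda>x. bproj P (d x)), ract = (\<lambda>x g. e (ract P (d x) g)),
           str = (\<lambda>x. str P (d x))\<rparr>"
  have "principal_bundle G TG M P'"
    by (rule principal_bundle_transport[OF assms(2) _ prin, of P' e d])
      (use assms(1) hom in \<open>auto simp: P'_def group.is_monoid monoid.m_closed\<close>)
  moreover have "continuous_map (total P') TH (str P')"
    using continuous_map_compose[OF d, of TH "str P"] P
    by (simp add: bibundle_def P'_def comp_def)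
  ultimately have "bibundle G TG H TH t M P'"
    using P unfolding bibundle_def by (simp add: P'_def de dS actS)
  moreover have "bundle_iso G P P' e \<and> (\<forall>p \<in> topspace (total P). str P' (e p) = str P p)"
    using hom homeomorphic_maps_imp_map[OF hom]
    unfolding bundle_iso_def homeomorphic_maps_def by (simp add: P'_def)
  ultimately show ?thesis unfolding bibundle_isomorphic_def by blast
qed


section \<open>The bibundle associated with a bundle for a subgroup\<close>

definition balanced_rel ::
    "('g, 'b) monoid_scheme \<Rightarrow> 'g set \<Rightarrow> ('q, 'm, 'g, 'z) pbundle_scheme \<Rightarrow> (('q \<times> 'g) \<times> ('q \<times> 'g)) set"
where
  "balanced_rel G N Q =
     {((q, g), (ract Q q a, inv\<^bsub>G\<^esub> a \<otimes>\<^bsub>G\<^esub> g)) | q g a.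
        q \<in> topspace (total Q) \<and> g \<in> carrier G \<and> a \<in> N}"

text \<open>The total space consists of the classes \<open>[q, g]\<close>; since \<open>[q, g] g' = [q, g g']\<close>, the action
  moves a class, as a set of pairs, to its image under \<open>(q, g) \<mapsto> (q, g g')\<close>.\<close>

definition iota ::
    "('g, 'b) monoid_scheme \<Rightarrow> 'g topology \<Rightarrow> 'g set \<Rightarrow> ('g \<Rightarrow> 'h) \<Rightarrow> ('q, 'm, 'g) pbundle \<Rightarrow>
     (('q \<times> 'g) set, 'm, 'g, 'h) bibundle" where
  "iota G TG N t Q =
     \<lparr>total = quotient_topology (prod_topology (total Q) TG) (\<lambda>x. balanced_rel G N Q `` {x}),
      bproj = (\<lambda>c. the_elem ((\<lambda>(q, g). bproj Q q) ` c)),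
      ract = (\<lambda>c g'. (\<lambda>(q, g). (q, g \<otimes>\<^bsub>G\<^esub> g')) ` c),
      str = (\<lambda>c. the_elem ((\<lambda>(q, g). t g) ` c))\<rparr>"


section \<open>Pointed sets of isomorphism classes\<close>

text \<open>Isomorphism classes are formed among bundles whose total space is a set of elements of type
  \<open>'m \<times> 'g\<close>; every principal bundle, on whatever type, is isomorphic to such a one (lemmas
  \<open>bundle_representable\<close> and \<open>bibundle_representable\<close>).  The class of a bundle on any type is
  thus a well-defined element.\<close>

type_synonym 'a pointed = "'a set \<times> 'a"

definition pointed_map :: "'a pointed \<Rightarrow> 'b pointed \<Rightarrow> ('a \<Rightarrow> 'b) \<Rightarrow> bool" where
  "pointed_map A B f \<longleftrightarrow>
     snd A \<in> fst A \<and> snd B \<in> fst B \<and> f \<in> fst A \<rightarrow> fst B \<and> f (snd A) = snd B"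

definition exact_at :: "'a pointed \<Rightarrow> ('a \<Rightarrow> 'b) \<Rightarrow> 'b pointed \<Rightarrow> ('b \<Rightarrow> 'c) \<Rightarrow> 'c pointed \<Rightarrow> bool" where
  "exact_at A f B g C \<longleftrightarrow>
     pointed_map A B f \<and> pointed_map B C g \<and> f ` fst A = {y \<in> fst B. g y = snd C}"

definition one_pointed :: "unit pointed" where
  "one_pointed = ({()}, ())"

definition bundle_class ::
    "('g, 'b) monoid_scheme \<Rightarrow> 'g topology \<Rightarrow> 'm topology \<Rightarrow> ('p, 'm, 'g) pbundle \<Rightarrow>
     ('m \<times> 'g, 'm, 'g) pbundle set" where
  "bundle_class G TG M P = {P'. principal_bundle G TG M P' \<and> bundle_isomorphic G P' P}"

definition bibundle_class ::
    "('g, 'b) monoid_scheme \<Rightarrow> 'g topology \<Rightarrow> ('h, 'c) monoid_scheme \<Rightarrow> 'h topology \<Rightarrow> ('g \<Rightarrow> 'h) \<Rightarrow>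
     'm topology \<Rightarrow> ('p, 'm, 'g, 'h) bibundle \<Rightarrow> ('m \<times> 'g, 'm, 'g, 'h) bibundle set" where
  "bibundle_class G TG H TH t M P =
     {P'. bibundle G TG H TH t M P' \<and> bibundle_isomorphic G P' P}"

definition pi0_Bun ::
    "('g, 'b) monoid_scheme \<Rightarrow> 'g topology \<Rightarrow> 'm topology \<Rightarrow> ('m \<times> 'g, 'm, 'g) pbundle set pointed" where
  "pi0_Bun G TG M =
     ({bundle_class G TG M P | P :: ('m \<times> 'g, 'm, 'g) pbundle. principal_bundle G TG M P},
      bundle_class G TG M (trivial_bundle G TG M))"

definition pi0_Bibun ::
    "('g, 'b) monoid_scheme \<Rightarrow> 'g topology \<Rightarrow> ('h, 'c) monoid_scheme \<Rightarrow> 'h topology \<Rightarrow> ('g \<Rightarrow> 'h) \<Rightarrow>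
     'm topology \<Rightarrow> ('m \<times> 'g, 'm, 'g, 'h) bibundle set pointed" where
  "pi0_Bibun G TG H TH t M =
     ({bibundle_class G TG H TH t M P | P :: ('m \<times> 'g, 'm, 'g, 'h) bibundle.
         bibundle G TG H TH t M P},
      bibundle_class G TG H TH t M (trivial_bibundle G TG t M))"

definition pi0_iota ::
    "('g, 'b) monoid_scheme \<Rightarrow> 'g topology \<Rightarrow> 'g set \<Rightarrow> ('h, 'c) monoid_scheme \<Rightarrow> 'h topology \<Rightarrow>
     ('g \<Rightarrow> 'h) \<Rightarrow> 'm topology \<Rightarrow> ('m \<times> 'g, 'm, 'g) pbundle set \<Rightarrow>
     ('m \<times> 'g, 'm, 'g, 'h) bibundle set" where
  "pi0_iota G TG N H TH t M c = (\<Union>Q\<in>c. bibundle_class G TG H TH t M (iota G TG N t Q))"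

definition pi0_type ::
    "('g, 'b) monoid_scheme \<Rightarrow> ('h, 'c) monoid_scheme \<Rightarrow> ('g \<Rightarrow> 'h) \<Rightarrow> 'm topology \<Rightarrow>
     ('m \<times> 'g, 'm, 'g, 'h) bibundle set \<Rightarrow> 'm \<Rightarrow> 'h set" where
  "pi0_type G H t M c = the_elem (type_map G H t M ` c)"

definition const_one :: "'m topology \<Rightarrow> ('x, 'c) monoid_scheme \<Rightarrow> 'm \<Rightarrow> 'x" where
  "const_one M X = (\<lambda>m \<in> topspace M. \<one>\<^bsub>X\<^esub>)"

text \<open>Maps are extensional functions on the underlying set of \<open>M\<close>.\<close>

definition Map_pointed ::
    "'m topology \<Rightarrow> ('x, 'c) monoid_scheme \<Rightarrow> 'x topology \<Rightarrow> ('m \<Rightarrow> 'x) pointed" where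
  "Map_pointed M X TX = ({f \<in> extensional (topspace M). continuous_map M TX f}, const_one M X)"


section \<open>The crossed module of automorphisms\<close>

definition group_center :: "('a, 'b) monoid_scheme \<Rightarrow> 'a set" where
  "group_center G = {z \<in> carrier G. \<forall>g \<in> carrier G. z \<otimes>\<^bsub>G\<^esub> g = g \<otimes>\<^bsub>G\<^esub> z}"

definition Ad :: "('a, 'b) monoid_scheme \<Rightarrow> 'a \<Rightarrow> 'a \<Rightarrow> 'a" where
  "Ad G g = (\<lambda>x \<in> carrier G. g \<otimes>\<^bsub>G\<^esub> x \<otimes>\<^bsub>G\<^esub> inv\<^bsub>G\<^esub> g)"

abbreviation Inn :: "('a, 'b) monoid_scheme \<Rightarrow> ('a \<Rightarrow> 'a) set" where
  "Inn G \<equiv> Ad G ` carrier G"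

definition Out :: "('a, 'b) monoid_scheme \<Rightarrow> 'a topology \<Rightarrow> ('a \<Rightarrow> 'a) set monoid" where
  "Out G TG = TopAut G TG Mod Inn G"

end

theory Submission
  imports Defs
begin

text \<open>A morphism of principal bundles over the identity of \<open>M\<close> is an isomorphism, so every
  comparison reduces to producing an equivariant continuous map.  A \<open>G\<^sub>1\<close>-equivariant map from
  \<open>Q\<close> into \<open>\<psi>\<^sup>-\<^sup>1(1) \<subseteq> P\<close> induces \<open>\<iota>(Q) \<cong> P\<close>; conversely an isomorphism from \<open>\<iota>(Q)\<close> to the
  trivial bibundle restricts along \<open>q \<mapsto> [q, 1]\<close> to a map from \<open>Q\<close> to \<open>M \<times> G\<^sub>1\<close>.  If \<open>P\<close> has type 1,
  then \<open>\<psi>\<close> takes values in \<open>t(G) = G/G\<^sub>1\<close>, and a local section of \<open>G \<rightarrow> G/G\<^sub>1\<close> moves local sections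
  of \<open>P\<close> into \<open>\<psi>\<^sup>-\<^sup>1(1)\<close>, which is therefore a principal \<open>G\<^sub>1\<close>-bundle \<open>R\<close> with \<open>\<iota>(R) \<cong> P\<close>.\<close>

section \<open>Principal bundles through charts\<close>

text \<open>The total space of \<open>iota\<close> is a quotient, and the product of a quotient map
  with an identity map need not be a quotient map. Continuity of the action of \<open>G\<close> on
  it is therefore not descended from \<open>Q \<times> G\<close>; it is read off charts, where the
  action is right multiplication. Charts are also what makes the inverse of a bundle morphism
  continuous, since in a chart the group element carrying one point of a fibre to another is a
  quotient of coordinates. The theory is set up for an arbitrary topological group because it is
  applied both to \<open>G\<close> and to the kernel \<open>K\<close>.

  A second obstacle is one of types: isomorphism classes contain only bundles on
  \<open>'m \<times> 'g\<close>, whereas \<open>iota\<close> and the reduction of \<open>P\<close>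
  produce bundles on other types. Statements about classes therefore pass through isomorphic copies
  on the fixed type.\<close>

lemma continuous_map_comp:
  "continuous_map X Y f \<Longrightarrow> continuous_map Y Z g \<Longrightarrow> continuous_map X Z (\<lambda>x. g (f x))"
  using continuous_map_compose[of X Y f Z g] by (simp add: comp_def)

text \<open>The pasting lemma with every local piece equal to \<open>f\<close>, so that agreement on
  overlaps is automatic.\<close>

lemma continuous_map_locally:
  assumes "\<And>x. x \<in> topspace X \<Longrightarrow> \<exists>U. openin X U \<and> x \<in> U \<and> continuous_map (subtopology X U) Y f"
  shows "continuous_map X Y f"
proof (rule pasting_lemma[of "{U. openin X U \<and> continuous_map (subtopology X U) Y f}" X "\<lambda>U. U" Y "\<lambda>_. f"])
  fix x assume "x \<in> topspace X"
  then show "\<exists>U. U \<in> {U. openin X U \<and> continuous_map (subtopology X U) Y f} \<and> x \<in> U \<and> f x = f x"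
    using assms by blast
qed auto

context topological_group
begin

lemma continuous_map_mult_of:
  "continuous_map X T f \<Longrightarrow> continuous_map X T g \<Longrightarrow> continuous_map X T (\<lambda>x. f x \<otimes> g x)"
  using continuous_map_comp[OF continuous_map_pairedI continuous_mult, of X f g] by simp

lemma continuous_map_inv_of:
  "continuous_map X T f \<Longrightarrow> continuous_map X T (\<lambda>x. inv (f x))"
  using continuous_map_comp[OF _ continuous_inv] .

lemma topological_group_subgroup:
  assumes "subgroup N G"
  shows "topological_group (G\<lparr>carrier := N\<rparr>) (subtopology T N)"
proof -
  have N: "N \<subseteq> carrier G" using assms by (rule subgroup.subset)
  interpret K: group "G\<lparr>carrier := N\<rparr>" using subgroup.subgroup_is_group[OF assms is_group] .
  show ?thesis
  proof
    show "topspace (subtopology T N) = carrier (G\<lparr>carrier := N\<rparr>)"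
      using N topspace_eq by auto
    show "continuous_map (prod_topology (subtopology T N) (subtopology T N)) (subtopology T N)
        (\<lambda>(x, y). x \<otimes>\<^bsub>G\<lparr>carrier := N\<rparr>\<^esub> y)"
      using continuous_map_from_subtopology[OF continuous_mult, of "N \<times> N"] subgroup.m_closed[OF assms]
      by (auto simp: continuous_map_in_subtopology subtopology_Times)
    have "continuous_map (subtopology T N) (subtopology T N) (\<lambda>x. inv x)"
      using continuous_map_from_subtopology[OF continuous_inv, of N] subgroup.m_inv_closed[OF assms]
      by (auto simp: continuous_map_in_subtopology)
    then show "continuous_map (subtopology T N) (subtopology T N) (\<lambda>x. inv\<^bsub>G\<lparr>carrier := N\<rparr>\<^esub> x)"
      by (rule continuous_map_eq) (use assms in \<open>auto simp: m_inv_consistent\<close>)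
  qed
qed

end

text \<open>Besides \<phi>, a chart records its group coordinate \<tau>: the inverse of \<phi> is
  \<open>p \<mapsto> (bproj P p, \<tau> p)\<close>. With this formula, continuity of the inverse
  comes down to continuity of the projection and of \<tau>.\<close>

definition bundle_chart ::
    "('g, 'b) monoid_scheme \<Rightarrow> 'g topology \<Rightarrow> 'm topology \<Rightarrow> ('p, 'm, 'g, 'z) pbundle_scheme \<Rightarrow>
     'm set \<Rightarrow> ('m \<times> 'g \<Rightarrow> 'p) \<Rightarrow> ('p \<Rightarrow> 'g) \<Rightarrow> bool" where
  "bundle_chart G TG M P U \<phi> \<tau> \<longleftrightarrow>
     openin M U \<and>
     continuous_map (prod_topology (subtopology M U) TG) (total P) \<phi> \<and>
     continuous_map (subtopology (total P) {p \<in> topspace (total P). bproj P p \<in> U}) TG \<tau> \<and>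
     (\<forall>u \<in> U. \<forall>g \<in> carrier G. bproj P (\<phi> (u, g)) = u \<and> \<tau> (\<phi> (u, g)) = g) \<and>
     (\<forall>p \<in> topspace (total P). bproj P p \<in> U \<longrightarrow> \<phi> (bproj P p, \<tau> p) = p) \<and>
     (\<forall>u \<in> U. \<forall>g \<in> carrier G. \<forall>g' \<in> carrier G. \<phi> (u, g \<otimes>\<^bsub>G\<^esub> g') = ract P (\<phi> (u, g)) g')"

context
  fixes G :: "('g, 'b) monoid_scheme" (structure) and T M P U \<phi> \<tau>
  assumes chart: "bundle_chart G T M P U \<phi> \<tau>"
begin

lemma chart_open: "openin M U"
  and chart_cont: "continuous_map (prod_topology (subtopology M U) T) (total P) \<phi>"
  and chart_coord_cont: "continuous_map (subtopology (total P) {p \<in> topspace (total P). bproj P p \<in> U}) T \<tau>"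
  and chart_proj: "u \<in> U \<Longrightarrow> g \<in> carrier G \<Longrightarrow> bproj P (\<phi> (u, g)) = u"
  and chart_coord: "u \<in> U \<Longrightarrow> g \<in> carrier G \<Longrightarrow> \<tau> (\<phi> (u, g)) = g"
  and chart_inverse: "p \<in> topspace (total P) \<Longrightarrow> bproj P p \<in> U \<Longrightarrow> \<phi> (bproj P p, \<tau> p) = p"
  and chart_mult: "u \<in> U \<Longrightarrow> g \<in> carrier G \<Longrightarrow> g' \<in> carrier G \<Longrightarrow> \<phi> (u, g \<otimes> g') = ract P (\<phi> (u, g)) g'"
  using chart unfolding bundle_chart_def by blast+

lemma chart_subset: "U \<subseteq> topspace M"
  using chart_open openin_subset by blast

lemma chart_mem: "topspace T = carrier G \<Longrightarrow> u \<in> U \<Longrightarrow> g \<in> carrier G \<Longrightarrow> \<phi> (u, g) \<in> topspace (total P)"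
  using chart_cont chart_subset by (fastforce simp: continuous_map_def Pi_iff)

lemma chart_coord_closed:
  "topspace T = carrier G \<Longrightarrow> p \<in> topspace (total P) \<Longrightarrow> bproj P p \<in> U \<Longrightarrow> \<tau> p \<in> carrier G"
  using chart_coord_cont by (auto simp: continuous_map_def Pi_iff)

lemma chart_restrict:
  assumes "openin M V" "V \<subseteq> U"
  shows "bundle_chart G T M P V \<phi> \<tau>"
  unfolding bundle_chart_def
proof (intro conjI)
  show "continuous_map (prod_topology (subtopology M V) T) (total P) \<phi>"
    using continuous_map_from_subtopology[OF chart_cont, of "V \<times> topspace T"] assms
    by (simp add: subtopology_Times subtopology_subtopology inf.absorb2)
  show "continuous_map (subtopology (total P) {p \<in> topspace (total P). bproj P p \<in> V}) T \<tau>"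
    using chart_coord_cont by (rule continuous_map_from_subtopology_mono) (use assms in auto)
qed (use assms in \<open>auto simp: chart_proj chart_coord chart_inverse chart_mult subset_iff\<close>)

end

context topological_group
begin

text \<open>In coordinates the action is right multiplication, because \<tau> inverts the
  equivariant map \<phi>. Division in \<open>G\<close> then recovers the element that carries one
  point of a fibre to another.\<close>

lemma chart_coord_mult:
  assumes "bundle_chart G T M P U \<phi> \<tau>" "p \<in> topspace (total P)" "bproj P p \<in> U" "g \<in> carrier G"
  shows "\<tau> (ract P p g) = \<tau> p \<otimes> g"
proof -
  note c = chart_coord_closed[OF assms(1) topspace_eq assms(2,3)]
  have "ract P p g = \<phi> (bproj P p, \<tau> p \<otimes> g)"
    using chart_mult[OF assms(1,3) c assms(4)] chart_inverse[OF assms(1-3)] by simp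
  then show ?thesis using chart_coord[OF assms(1,3)] c assms(4) by simp
qed

text \<open>The action axioms follow from local triviality alone.\<close>

lemma principal_bundleI:
  fixes P :: "('p, 'm, 'a, 'z) pbundle_scheme"
  assumes proj: "continuous_map (total P) M (bproj P)"
    and charts: "\<And>m. m \<in> topspace M \<Longrightarrow> \<exists>U \<phi> \<tau>. m \<in> U \<and> bundle_chart G T M P U \<phi> \<tau>"
  shows "principal_bundle G T M P"
proof -
  have projM: "bproj P p \<in> topspace M" if "p \<in> topspace (total P)" for p
    using proj that by (auto simp: continuous_map_def Pi_iff)
  \<comment> \<open>Writing a point as \<open>\<phi> (u, g)\<close> turns the action axioms into the
    unit and associativity laws of \<open>G\<close>.\<close>
  have loc: "\<exists>u U \<phi> \<tau> g. u \<in> U \<and> g \<in> carrier G \<and> p = \<phi> (u, g) \<and> bproj P p = u \<and> bundle_chart G T M P U \<phi> \<tau>"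
    if p: "p \<in> topspace (total P)" for p
  proof -
    obtain U \<phi> \<tau> where c: "bproj P p \<in> U" "bundle_chart G T M P U \<phi> \<tau>" using charts projM p by meson
    then show ?thesis using chart_inverse[OF c(2) p c(1)] chart_coord_closed[OF c(2) topspace_eq p c(1)]
      by metis
  qed
  show ?thesis
    unfolding principal_bundle_def
  proof (intro conjI ballI)
    show "continuous_map (total P) M (bproj P)" by fact
    show "continuous_map (prod_topology (total P) T) (total P) (\<lambda>(p, g). ract P p g)"
    proof (rule continuous_map_locally)
      fix x assume "x \<in> topspace (prod_topology (total P) T)"
      then obtain p h where x: "x = (p, h)" "p \<in> topspace (total P)" "h \<in> topspace T" by auto
      obtain U \<phi> \<tau> where U: "bproj P p \<in> U" and c: "bundle_chart G T M P U \<phi> \<tau>"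
        using charts projM x by meson
      let ?W = "{p \<in> topspace (total P). bproj P p \<in> U}"
      have W: "openin (total P) ?W"
        using proj chart_open[OF c] by (rule openin_continuous_map_preimage)
      let ?X = "prod_topology (subtopology (total P) ?W) T"
      have "continuous_map ?X (subtopology M U) (\<lambda>x. bproj P (fst x))"
        using continuous_map_comp[OF continuous_map_fst continuous_map_from_subtopology[OF proj]]
        by (auto simp: continuous_map_in_subtopology)
      moreover have "continuous_map ?X T (\<lambda>x. \<tau> (fst x) \<otimes> snd x)"
        by (intro continuous_map_mult_of continuous_map_comp[OF continuous_map_fst chart_coord_cont[OF c]]
            continuous_map_snd)
      \<comment> \<open>Over \<open>U\<close> the action is
        \<open>(p, h) \<mapsto> \<phi> (bproj P p, \<tau> p \<otimes> h)\<close>, a composite of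
        continuous maps.\<close>
      ultimately have "continuous_map ?X (total P) (\<lambda>x. \<phi> (bproj P (fst x), \<tau> (fst x) \<otimes> snd x))"
        by (intro continuous_map_comp[OF _ chart_cont[OF c]] continuous_map_pairedI)
      then have "continuous_map ?X (total P) (\<lambda>(p, g). ract P p g)"
        by (rule continuous_map_eq)
          (auto simp: topspace_eq chart_mult[OF c] chart_inverse[OF c] chart_coord_closed[OF c topspace_eq])
      then show "\<exists>U. openin (prod_topology (total P) T) U \<and> x \<in> U \<and>
          continuous_map (subtopology (prod_topology (total P) T) U) (total P) (\<lambda>(p, g). ract P p g)"
        using W x U by (intro exI[of _ "?W \<times> topspace T"])
          (auto simp: openin_prod_Times_iff subtopology_Times)
    qed
    show "ract P p \<one> = p" if "p \<in> topspace (total P)" for p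
      using loc[OF that] chart_mult r_one one_closed by metis
    show "ract P (ract P p g) g' = ract P p (g \<otimes> g')"
      if "p \<in> topspace (total P)" "g \<in> carrier G" "g' \<in> carrier G" for p g g'
      using loc[OF that(1)] that(2,3) chart_mult[of G T M P] m_assoc m_closed by metis
    show "bproj P (ract P p g) = bproj P p" if "p \<in> topspace (total P)" "g \<in> carrier G" for p g
      using loc[OF that(1)] that(2) chart_mult[of G T M P] chart_proj[of G T M P] m_closed by metis
    show "\<exists>U \<phi>. openin M U \<and> m \<in> U \<and>
        homeomorphic_map (prod_topology (subtopology M U) T)
          (subtopology (total P) {p \<in> topspace (total P). bproj P p \<in> U}) \<phi> \<and>
        (\<forall>u \<in> U. \<forall>g \<in> carrier G. bproj P (\<phi> (u, g)) = u) \<and>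
        (\<forall>u \<in> U. \<forall>g \<in> carrier G. \<forall>g' \<in> carrier G. \<phi> (u, g \<otimes> g') = ract P (\<phi> (u, g)) g')"
      if "m \<in> topspace M" for m
    proof -
      from charts[OF that] obtain U \<phi> \<tau> where U: "m \<in> U" and c: "bundle_chart G T M P U \<phi> \<tau>"
        by meson
      let ?W = "{p \<in> topspace (total P). bproj P p \<in> U}"
      have "homeomorphic_maps (prod_topology (subtopology M U) T) (subtopology (total P) ?W)
          \<phi> (\<lambda>p. (bproj P p, \<tau> p))"
        unfolding homeomorphic_maps_def
      proof (intro conjI)
        show "continuous_map (prod_topology (subtopology M U) T) (subtopology (total P) ?W) \<phi>"
          using chart_cont[OF c] chart_mem[OF c topspace_eq] topspace_eq chart_proj[OF c]
          by (auto simp: continuous_map_in_subtopology)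
        show "continuous_map (subtopology (total P) ?W) (prod_topology (subtopology M U) T) (\<lambda>p. (bproj P p, \<tau> p))"
          using proj chart_coord_cont[OF c]
          by (auto simp: continuous_map_paired continuous_map_in_subtopology continuous_map_from_subtopology)
      qed (use chart_proj[OF c] chart_coord[OF c] chart_inverse[OF c] topspace_eq in auto)
      then show ?thesis
        using U chart_open[OF c] chart_proj[OF c] chart_mult[OF c] homeomorphic_maps_imp_map
        by (intro exI[of _ U] exI[of _ \<phi>]) auto
    qed
  qed
qed

section \<open>Fibres of a principal bundle as free and transitive \<open>G\<close>-spaces\<close>

context
  fixes M and P :: "('p, 'm, 'a, 'z) pbundle_scheme"
  assumes P: "principal_bundle G T M P"
begin

lemma bproj_cont: "continuous_map (total P) M (bproj P)"
  by (rule P[unfolded principal_bundle_def, THEN conjunct1])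

lemma bproj_mem: "p \<in> topspace (total P) \<Longrightarrow> bproj P p \<in> topspace M"
  using bproj_cont by (auto simp: continuous_map_def Pi_iff)

lemma ract_cont: "continuous_map (prod_topology (total P) T) (total P) (\<lambda>(p, g). ract P p g)"
  by (rule P[unfolded principal_bundle_def, THEN conjunct2, THEN conjunct1])

lemma ract_cont_of:
  "continuous_map X (total P) f \<Longrightarrow> continuous_map X T g \<Longrightarrow>
   continuous_map X (total P) (\<lambda>x. ract P (f x) (g x))"
  using continuous_map_comp[OF continuous_map_pairedI ract_cont, of X f g] by simp

lemma ract_mem: "p \<in> topspace (total P) \<Longrightarrow> g \<in> carrier G \<Longrightarrow> ract P p g \<in> topspace (total P)"
  using ract_cont by (auto simp: continuous_map_def Pi_iff topspace_eq)

lemma ract_one: "p \<in> topspace (total P) \<Longrightarrow> ract P p \<one> = p"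
  by (rule P[unfolded principal_bundle_def, THEN conjunct2, THEN conjunct2, THEN conjunct1, rule_format])

lemma ract_ract:
  "p \<in> topspace (total P) \<Longrightarrow> g \<in> carrier G \<Longrightarrow> g' \<in> carrier G \<Longrightarrow> ract P (ract P p g) g' = ract P p (g \<otimes> g')"
  by (rule P[unfolded principal_bundle_def, THEN conjunct2, THEN conjunct2, THEN conjunct2, THEN conjunct1, rule_format])

lemma bproj_ract: "p \<in> topspace (total P) \<Longrightarrow> g \<in> carrier G \<Longrightarrow> bproj P (ract P p g) = bproj P p"
  by (rule P[unfolded principal_bundle_def, THEN conjunct2, THEN conjunct2, THEN conjunct2, THEN conjunct2, THEN conjunct1, rule_format])

lemma chart_exists:
  assumes "m \<in> topspace M"
  obtains U \<phi> \<tau> where "m \<in> U" "bundle_chart G T M P U \<phi> \<tau>"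
proof -
  have "\<exists>U \<phi>. openin M U \<and> m \<in> U \<and>
        homeomorphic_map (prod_topology (subtopology M U) T)
          (subtopology (total P) {p \<in> topspace (total P). bproj P p \<in> U}) \<phi> \<and>
        (\<forall>u \<in> U. \<forall>g \<in> carrier G. bproj P (\<phi> (u, g)) = u) \<and>
        (\<forall>u \<in> U. \<forall>g \<in> carrier G. \<forall>g' \<in> carrier G. \<phi> (u, g \<otimes> g') = ract P (\<phi> (u, g)) g')"
    by (rule P[unfolded principal_bundle_def, THEN conjunct2, THEN conjunct2, THEN conjunct2, THEN conjunct2,
        THEN conjunct2, THEN bspec, OF assms])
  then obtain U \<phi> where U: "openin M U" "m \<in> U"
    and h: "homeomorphic_map (prod_topology (subtopology M U) T)
          (subtopology (total P) {p \<in> topspace (total P). bproj P p \<in> U}) \<phi>"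
    and pr: "\<forall>u \<in> U. \<forall>g \<in> carrier G. bproj P (\<phi> (u, g)) = u"
    and ac: "\<forall>u \<in> U. \<forall>g \<in> carrier G. \<forall>g' \<in> carrier G. \<phi> (u, g \<otimes> g') = ract P (\<phi> (u, g)) g'"
    by (elim exE conjE) (rule that)
  have UM: "U \<subseteq> topspace M" using U openin_subset by blast
  from h obtain \<psi> where hm: "homeomorphic_maps (prod_topology (subtopology M U) T)
          (subtopology (total P) {p \<in> topspace (total P). bproj P p \<in> U}) \<phi> \<psi>"
    by (auto simp: homeomorphic_map_maps)
  then have \<phi>c: "continuous_map (prod_topology (subtopology M U) T) (total P) \<phi>"
    and \<psi>c: "continuous_map (subtopology (total P) {p \<in> topspace (total P). bproj P p \<in> U})
          (prod_topology (subtopology M U) T) \<psi>"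
    and \<psi>\<phi>: "\<And>u g. u \<in> U \<Longrightarrow> g \<in> carrier G \<Longrightarrow> \<psi> (\<phi> (u, g)) = (u, g)"
    and \<phi>\<psi>: "\<And>p. p \<in> topspace (total P) \<Longrightarrow> bproj P p \<in> U \<Longrightarrow> \<phi> (\<psi> p) = p"
    using UM by (auto simp: homeomorphic_maps_def continuous_map_in_subtopology topspace_eq)
  \<comment> \<open>The first component of \<open>\<psi> p\<close> is \<open>bproj P p\<close>,
    since \<phi> lies over the identity of \<open>U\<close>; so the second component of \<psi> can
    serve as the coordinate of the chart.\<close>
  have \<psi>1: "\<phi> (bproj P p, snd (\<psi> p)) = p" if "p \<in> topspace (total P)" "bproj P p \<in> U" for p
  proof -
    have "\<psi> p \<in> topspace (prod_topology (subtopology M U) T)"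
      using \<psi>c that by (auto simp: continuous_map_def Pi_iff)
    then obtain u g where ug: "\<psi> p = (u, g)" "u \<in> U" "g \<in> carrier G" by (auto simp: topspace_eq)
    then have "bproj P p = u" using pr \<phi>\<psi>[OF that] by metis
    with ug \<phi>\<psi>[OF that] show ?thesis by simp
  qed
  have "bundle_chart G T M P U \<phi> (snd \<circ> \<psi>)"
    unfolding bundle_chart_def using U \<phi>c continuous_map_snd_of[OF \<psi>c] pr ac \<psi>\<phi> \<psi>1 by simp
  with U that show thesis by blast
qed

text \<open>Freeness of the action: in a chart it is left cancellation in \<open>G\<close>.\<close>

lemma ract_cancel:
  assumes "p \<in> topspace (total P)" "g \<in> carrier G" "g' \<in> carrier G" "ract P p g = ract P p g'"
  shows "g = g'"
proof -
  obtain U \<phi> \<tau> where c: "bproj P p \<in> U" "bundle_chart G T M P U \<phi> \<tau>"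
    using chart_exists bproj_mem assms by metis
  then have "\<tau> p \<otimes> g = \<tau> p \<otimes> g'" using chart_coord_mult[OF c(2)] assms by metis
  then show ?thesis using assms chart_coord_closed[OF c(2) topspace_eq] c by simp
qed

lemma ract_transitive:
  assumes "p \<in> topspace (total P)" "p' \<in> topspace (total P)" "bproj P p = bproj P p'"
  obtains g where "g \<in> carrier G" "ract P p g = p'"
  using principal_bundle_transitive[OF is_group topspace_eq P assms] by blast

end

text \<open>On each fibre an equivariant map between free and transitive \<open>G\<close>-spaces is
  bijective. Continuity of the inverse is local: for a section \<open>s\<close> of \<open>P\<close>,
  the points \<open>f (s q)\<close> and \<open>q\<close> lie in one fibre of \<open>Q\<close>, the
  group element between them depends continuously on \<open>q\<close>, and it carries
  \<open>s q\<close> to the preimage of \<open>q\<close>.\<close>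

lemma bundle_morphism_iso:
  fixes P :: "('p, 'm, 'a, 'z) pbundle_scheme" and Q :: "('q, 'm, 'a, 'w) pbundle_scheme"
  assumes P: "principal_bundle G T M P" and Q: "principal_bundle G T M Q"
    and f: "continuous_map (total P) (total Q) f"
    and fproj: "\<And>p. p \<in> topspace (total P) \<Longrightarrow> bproj Q (f p) = bproj P p"
    and fact: "\<And>p g. p \<in> topspace (total P) \<Longrightarrow> g \<in> carrier G \<Longrightarrow> f (ract P p g) = ract Q (f p) g"
  shows "bundle_iso G P Q f"
proof -
  have fmem: "f p \<in> topspace (total Q)" if "p \<in> topspace (total P)" for p
    using f that by (auto simp: continuous_map_def Pi_iff)
  have inj: "inj_on f (topspace (total P))"
  proof (rule inj_onI)
    fix p p' assume p: "p \<in> topspace (total P)" "p' \<in> topspace (total P)" and eq: "f p = f p'"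
    then have "bproj P p = bproj P p'" using fproj by metis
    then obtain g where g: "g \<in> carrier G" "ract P p g = p'" using ract_transitive[OF P p] by blast
    then have "ract Q (f p) g = ract Q (f p) \<one>"
      using eq fact p ract_one[OF Q] fmem by metis
    then have "g = \<one>" using ract_cancel[OF Q] fmem p g by blast
    then show "p = p'" using g ract_one[OF P] p by simp
  qed
  \<comment> \<open>\<open>inv_into\<close> is total, so the inverse can be named before
    \<open>f\<close> is known to be surjective. The fact \<open>local\<close> then supplies
    surjectivity and continuity of \<open>h\<close> together.\<close>
  define h where "h = inv_into (topspace (total P)) f"
  have hf: "h (f p) = p" if "p \<in> topspace (total P)" for p
    using inj that by (simp add: h_def)
  have local: "\<exists>W. openin (total Q) W \<and> q \<in> W \<and> W \<subseteq> f ` topspace (total P) \<and>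
      continuous_map (subtopology (total Q) W) (total P) h"
    if q: "q \<in> topspace (total Q)" for q
  proof -
    obtain U1 \<phi>1 \<tau>1 where U1: "bproj Q q \<in> U1" and c1: "bundle_chart G T M P U1 \<phi>1 \<tau>1"
      using chart_exists[OF P] bproj_mem[OF Q q] by metis
    obtain U2 \<phi>2 \<tau>2 where U2: "bproj Q q \<in> U2" and c2: "bundle_chart G T M Q U2 \<phi>2 \<tau>2"
      using chart_exists[OF Q] bproj_mem[OF Q q] by metis
    \<comment> \<open>Both bundles must be trivial over the same set: \<open>P\<close> provides the
      section \<open>s\<close>, and \<open>Q\<close> provides the coordinate \<open>\<tau>2\<close>
      used to divide.\<close>
    define U where "U = U1 \<inter> U2"
    have U: "openin M U" "bproj Q q \<in> U"
      using chart_open[OF c1] chart_open[OF c2] U1 U2 by (auto simp: U_def)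
    have d1: "bundle_chart G T M P U \<phi>1 \<tau>1" using chart_restrict[OF c1 U(1)] by (simp add: U_def)
    have d2: "bundle_chart G T M Q U \<phi>2 \<tau>2" using chart_restrict[OF c2 U(1)] by (simp add: U_def)
    define W where "W = {q \<in> topspace (total Q). bproj Q q \<in> U}"
    have W: "openin (total Q) W" "q \<in> W"
      using openin_continuous_map_preimage[OF bproj_cont[OF Q] U(1)] U q by (auto simp: W_def)
    define s where "s = (\<lambda>q. \<phi>1 (bproj Q q, \<one>))"
    \<comment> \<open>The quotient of the coordinates of \<open>f (s q)\<close> and \<open>q\<close>
      is the element carrying the former to the latter; by equivariance the same element carries
      \<open>s q\<close> to a point with image \<open>q\<close>.\<close>
    define k where "k = (\<lambda>q. ract P (s q) (inv (\<tau>2 (f (s q))) \<otimes> \<tau>2 q))"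
    have pc: "continuous_map (subtopology (total Q) W) (subtopology M U) (bproj Q)"
      using bproj_cont[OF Q] by (auto simp: continuous_map_in_subtopology W_def continuous_map_from_subtopology)
    have sc: "continuous_map (subtopology (total Q) W) (total P) s"
      unfolding s_def
      by (rule continuous_map_comp[OF _ chart_cont[OF d1]]) (simp add: continuous_map_paired pc topspace_eq)
    have smem: "s q \<in> topspace (total P)" "bproj P (s q) = bproj Q q" if "q \<in> W" for q
      using that chart_mem[OF d1 topspace_eq] chart_proj[OF d1] by (auto simp: s_def W_def)
    have fsc: "continuous_map (subtopology (total Q) W) (subtopology (total Q) W) (\<lambda>q. f (s q))"
      using continuous_map_comp[OF sc f] fmem smem fproj
      by (auto simp: continuous_map_in_subtopology W_def)
    have \<tau>c: "continuous_map (subtopology (total Q) W) T \<tau>2"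
      using chart_coord_cont[OF d2] by (simp add: W_def)
    have kc: "continuous_map (subtopology (total Q) W) (total P) k"
      unfolding k_def
      by (intro ract_cont_of[OF P] sc continuous_map_mult_of continuous_map_inv_of
          continuous_map_comp[OF fsc \<tau>c] \<tau>c)
    have k: "k q \<in> topspace (total P) \<and> f (k q) = q" if "q \<in> W" for q
    proof -
      have q: "q \<in> topspace (total Q)" "bproj Q q \<in> U" using that by (auto simp: W_def)
      have fs: "f (s q) \<in> topspace (total Q)" "bproj Q (f (s q)) = bproj Q q"
        using fmem smem that fproj by auto
      obtain g where g: "g \<in> carrier G" "ract Q (f (s q)) g = q"
        using ract_transitive[OF Q fs(1) q(1) fs(2)] by blast
      have "\<tau>2 q = \<tau>2 (f (s q)) \<otimes> g" using chart_coord_mult[OF d2 fs(1) _ g(1)] fs(2) q(2) g(2) by simp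
      then have "inv (\<tau>2 (f (s q))) \<otimes> \<tau>2 q = g"
        using g chart_coord_closed[OF d2 topspace_eq fs(1)] fs q by (simp add: inv_solve_left')
      then show ?thesis using g fact smem[OF that] ract_mem[OF P] by (simp add: k_def)
    qed
    have "continuous_map (subtopology (total Q) W) (total P) h"
      by (rule continuous_map_eq[OF kc]) (use hf k in fastforce)
    then show ?thesis using W k by (metis image_eqI subsetI)
  qed
  have "continuous_map (total Q) (total P) h"
    by (rule continuous_map_locally) (use local in blast)
  moreover have "f (h q) = q" if "q \<in> topspace (total Q)" for q
    using local[OF that] by (auto simp: h_def f_inv_into_f)
  ultimately have "homeomorphic_maps (total P) (total Q) f h"
    using f hf by (simp add: homeomorphic_maps_def)
  then show ?thesis
    using homeomorphic_maps_imp_map fproj fact by (auto simp: bundle_iso_def)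
qed

end

section \<open>The associated bibundle\<close>

sublocale crossed_module \<subseteq> t: group_hom G H t
  by unfold_locales (rule t_hom)

context crossed_module
begin

abbreviation "G1 \<equiv> kernel G H t"
abbreviation "K \<equiv> G\<lparr>carrier := G1\<rparr>"
abbreviation "TK \<equiv> subtopology TG G1"

lemma kernel_closed: "a \<in> G1 \<Longrightarrow> a \<in> carrier G"
  and t_kernel: "a \<in> G1 \<Longrightarrow> t a = \<one>\<^bsub>H\<^esub>"
  and kernelI: "a \<in> carrier G \<Longrightarrow> t a = \<one>\<^bsub>H\<^esub> \<Longrightarrow> a \<in> G1"
  by (auto simp: kernel_def)

lemma inv_mult_cancel:
  "a \<in> carrier G \<Longrightarrow> g \<in> carrier G \<Longrightarrow> inv a \<otimes> (a \<otimes> g) = g"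
  "a \<in> carrier G \<Longrightarrow> g \<in> carrier G \<Longrightarrow> a \<otimes> (inv a \<otimes> g) = g"
  by (simp_all flip: G.m_assoc)

end

sublocale crossed_module \<subseteq> K: topological_group "G\<lparr>carrier := kernel G H t\<rparr>" "subtopology TG (kernel G H t)"
  by (rule G.topological_group_subgroup[OF t.subgroup_kernel])

section \<open>Orbits of \<open>G1\<close> on \<open>Q \<times> G\<close> and the maps that descend
  to them\<close>

context crossed_module
begin

text \<open>The point \<open>[q, g]\<close> of \<open>iota\<close>, which is itself a set of pairs.
  For \<open>q\<close> in the total space and \<open>g\<close> in \<open>G\<close> it is the full
  \<open>G1\<close>-orbit, so identities between classes are equalities of sets.\<close>

definition balanced_class :: "('q, 'm, 'g, 'z) pbundle_scheme \<Rightarrow> 'q \<Rightarrow> 'g \<Rightarrow> ('q \<times> 'g) set" where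
  "balanced_class Q q g = balanced_rel G G1 Q `` {(q, g)}"

context
  fixes M and Q :: "('q, 'm, 'g) pbundle"
  assumes Q: "principal_bundle K TK M Q"
begin

lemma sub_ract_mem: "q \<in> topspace (total Q) \<Longrightarrow> a \<in> G1 \<Longrightarrow> ract Q q a \<in> topspace (total Q)"
  using K.ract_mem[OF Q] by simp

lemma sub_ract_one: "q \<in> topspace (total Q) \<Longrightarrow> ract Q q \<one> = q"
  using K.ract_one[OF Q] by simp

lemma sub_ract_ract:
  "q \<in> topspace (total Q) \<Longrightarrow> a \<in> G1 \<Longrightarrow> b \<in> G1 \<Longrightarrow> ract Q (ract Q q a) b = ract Q q (a \<otimes> b)"
  using K.ract_ract[OF Q] by simp

lemma sub_bproj_ract: "q \<in> topspace (total Q) \<Longrightarrow> a \<in> G1 \<Longrightarrow> bproj Q (ract Q q a) = bproj Q q"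
  using K.bproj_ract[OF Q] by simp

lemma balanced_class_eq:
  "q \<in> topspace (total Q) \<Longrightarrow> g \<in> carrier G \<Longrightarrow>
   balanced_class Q q g = {(ract Q q a, inv a \<otimes> g) | a. a \<in> G1}"
  unfolding balanced_class_def balanced_rel_def by auto

lemma balanced_class_refl:
  "q \<in> topspace (total Q) \<Longrightarrow> g \<in> carrier G \<Longrightarrow> (q, g) \<in> balanced_class Q q g"
  using balanced_class_eq sub_ract_one subgroup.one_closed[OF t.subgroup_kernel] by force

text \<open>The substitution \<open>c = a \<otimes> b\<close> turns the orbit of
  \<open>(q a, g)\<close> into that of \<open>(q, a g)\<close>, and left translation by
  \<open>a\<close> permutes \<open>G1\<close>.\<close>

lemma balanced_class_shift:
  assumes q: "q \<in> topspace (total Q)" and a: "a \<in> G1" and g: "g \<in> carrier G"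
  shows "balanced_class Q (ract Q q a) g = balanced_class Q q (a \<otimes> g)"
proof -
  note aG = kernel_closed[OF a]
  have shift: "(ract Q (ract Q q a) b, inv b \<otimes> g) = (ract Q q (a \<otimes> b), inv (a \<otimes> b) \<otimes> (a \<otimes> g))"
    if "b \<in> G1" for b
    using q a g that kernel_closed[OF that] aG
    by (simp add: sub_ract_ract G.inv_mult_group G.m_assoc inv_mult_cancel)
  have "balanced_class Q (ract Q q a) g =
      (\<lambda>c. (ract Q q c, inv c \<otimes> (a \<otimes> g))) ` ((\<lambda>b. a \<otimes> b) ` G1)"
    unfolding balanced_class_eq[OF sub_ract_mem[OF q a] g] image_image Setcompr_eq_image
    by (rule image_cong) (simp_all add: shift)
  also have "(\<lambda>b. a \<otimes> b) ` G1 = G1"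
  proof
    show "(\<lambda>b. a \<otimes> b) ` G1 \<subseteq> G1"
      using a subgroup.m_closed[OF t.subgroup_kernel] by blast
    show "G1 \<subseteq> (\<lambda>b. a \<otimes> b) ` G1"
    proof
      fix c assume c: "c \<in> G1"
      then have "inv a \<otimes> c \<in> G1"
        using a subgroup.m_closed[OF t.subgroup_kernel] subgroup.m_inv_closed[OF t.subgroup_kernel] by blast
      moreover have "c = a \<otimes> (inv a \<otimes> c)" using c aG kernel_closed by (simp flip: G.m_assoc)
      ultimately show "c \<in> (\<lambda>b. a \<otimes> b) ` G1" by blast
    qed
  qed
  finally show ?thesis using q aG g by (auto simp: balanced_class_eq)
qed

text \<open>Maps out of \<open>iota\<close> are written as \<open>the_elem\<close> of the image of a
  class. If \<open>F\<close> is constant along the orbit, this image is a singleton and its value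
  can be read off at \<open>(q, g)\<close>.\<close>

lemma the_elem_balanced_class:
  assumes "q \<in> topspace (total Q)" "g \<in> carrier G"
    and "\<And>a. a \<in> G1 \<Longrightarrow> F (ract Q q a, inv a \<otimes> g) = F (q, g)"
  shows "the_elem (F ` balanced_class Q q g) = F (q, g)"
  by (rule the_elem_image_unique)
    (use assms balanced_class_refl[OF assms(1,2)] in \<open>auto simp: balanced_class_eq\<close>)

abbreviation "E \<equiv> iota G TG G1 t Q"

lemma iota_quotient: "quotient_map (prod_topology (total Q) TG) (total E) (\<lambda>(q, g). balanced_class Q q g)"
  by (simp add: iota_def quotient_map_quotient_topology balanced_class_def case_prod_unfold)

lemma iota_class_mem:
  "q \<in> topspace (total Q) \<Longrightarrow> g \<in> carrier G \<Longrightarrow> balanced_class Q q g \<in> topspace (total E)"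
  using quotient_imp_surjective_map[OF iota_quotient] G.topspace_eq by force

lemma iota_cases:
  assumes "c \<in> topspace (total E)"
  obtains q g where "q \<in> topspace (total Q)" "g \<in> carrier G" "c = balanced_class Q q g"
proof -
  have "c \<in> (\<lambda>(q, g). balanced_class Q q g) ` (topspace (total Q) \<times> carrier G)"
    using assms quotient_imp_surjective_map[OF iota_quotient] G.topspace_eq by simp
  then show thesis using that by auto
qed

lemma iota_class_cont:
  "continuous_map X (total Q) f \<Longrightarrow> continuous_map X TG g \<Longrightarrow>
   continuous_map X (total E) (\<lambda>x. balanced_class Q (f x) (g x))"
  using continuous_map_comp[OF continuous_map_pairedI quotient_imp_continuous_map[OF iota_quotient], of X f g]
  by simp

lemma iota_bproj:
  "q \<in> topspace (total Q) \<Longrightarrow> g \<in> carrier G \<Longrightarrow> bproj E (balanced_class Q q g) = bproj Q q"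
  using the_elem_balanced_class[of q g "\<lambda>(q, g). bproj Q q"] by (simp add: iota_def sub_bproj_ract)

lemma iota_str:
  "q \<in> topspace (total Q) \<Longrightarrow> g \<in> carrier G \<Longrightarrow> str E (balanced_class Q q g) = t g"
  using the_elem_balanced_class[of q g "\<lambda>(q, g). t g"] by (simp add: iota_def kernel_closed t_kernel)

text \<open>The orbit changes \<open>g\<close> by factors on the left, the action by factors on the
  right; by associativity right translation carries orbits onto orbits.\<close>

lemma iota_ract:
  assumes "q \<in> topspace (total Q)" "g \<in> carrier G" "g' \<in> carrier G"
  shows "ract E (balanced_class Q q g) g' = balanced_class Q q (g \<otimes> g')"
proof -
  have "(\<lambda>(q, g). (q, g \<otimes> g')) ` balanced_class Q q g = balanced_class Q q (g \<otimes> g')"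
    unfolding balanced_class_eq[OF assms(1,2)] balanced_class_eq[OF assms(1) G.m_closed[OF assms(2,3)]]
      Setcompr_eq_image image_image
    by (rule image_cong) (use assms kernel_closed in \<open>simp_all add: G.m_assoc\<close>)
  then show ?thesis by (simp add: iota_def)
qed

lemma iota_bproj_cont: "continuous_map (total E) M (bproj E)"
proof (rule continuous_compose_quotient_map[OF iota_quotient])
  show "continuous_map (prod_topology (total Q) TG) M (bproj E \<circ> (\<lambda>(q, g). balanced_class Q q g))"
    by (rule continuous_map_eq[OF continuous_map_comp[OF continuous_map_fst K.bproj_cont[OF Q]]])
      (auto simp: iota_bproj G.topspace_eq)
qed

text \<open>A quotient map restricted to the preimage of an open set is again a quotient map, and
  the preimage of the part of \<open>E\<close> over \<open>U\<close> is the part of \<open>Q\<close>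
  over \<open>U\<close>, times \<open>G\<close>. The local form is what charts require, as their
  coordinates are controlled only over \<open>U\<close>.\<close>

lemma iota_descend_cont:
  assumes U: "openin M U"
    and F: "continuous_map (prod_topology (subtopology (total Q) {q \<in> topspace (total Q). bproj Q q \<in> U}) TG) Y F"
    and inv: "\<And>q g a. q \<in> topspace (total Q) \<Longrightarrow> bproj Q q \<in> U \<Longrightarrow> g \<in> carrier G \<Longrightarrow> a \<in> G1 \<Longrightarrow>
               F (ract Q q a, inv a \<otimes> g) = F (q, g)"
  shows "continuous_map (subtopology (total E) {c \<in> topspace (total E). bproj E c \<in> U}) Y (\<lambda>c. the_elem (F ` c))"
proof -
  let ?V = "{c \<in> topspace (total E). bproj E c \<in> U}"
  let ?W = "{q \<in> topspace (total Q). bproj Q q \<in> U}"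
  have V: "openin (total E) ?V" using iota_bproj_cont U by (rule openin_continuous_map_preimage)
  have "{x \<in> topspace (prod_topology (total Q) TG). (\<lambda>(q, g). balanced_class Q q g) x \<in> ?V} = ?W \<times> topspace TG"
    by (auto simp: iota_bproj G.topspace_eq iota_class_mem)
  with iota_quotient have "quotient_map (subtopology (prod_topology (total Q) TG) (?W \<times> topspace TG))
      (subtopology (total E) ?V) (\<lambda>(q, g). balanced_class Q q g)"
    using V by (intro quotient_map_restriction) auto
  then have q: "quotient_map (prod_topology (subtopology (total Q) ?W) TG)
      (subtopology (total E) ?V) (\<lambda>(q, g). balanced_class Q q g)"
    by (simp add: subtopology_Times)
  show ?thesis
  proof (rule continuous_compose_quotient_map[OF q])
    show "continuous_map (prod_topology (subtopology (total Q) ?W) TG) Y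
        ((\<lambda>c. the_elem (F ` c)) \<circ> (\<lambda>(q, g). balanced_class Q q g))"
      by (rule continuous_map_eq[OF F]) (auto simp: the_elem_balanced_class inv G.topspace_eq)
  qed
qed

lemma iota_descend_cont_total:
  assumes F: "continuous_map (prod_topology (total Q) TG) Y F"
    and inv: "\<And>q g a. q \<in> topspace (total Q) \<Longrightarrow> g \<in> carrier G \<Longrightarrow> a \<in> G1 \<Longrightarrow>
               F (ract Q q a, inv a \<otimes> g) = F (q, g)"
  shows "continuous_map (total E) Y (\<lambda>c. the_elem (F ` c))"
proof -
  have "{q \<in> topspace (total Q). bproj Q q \<in> topspace M} = topspace (total Q)"
    using K.bproj_mem[OF Q] by auto
  moreover have "{c \<in> topspace (total E). bproj E c \<in> topspace M} = topspace (total E)"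
    using iota_bproj_cont by (auto simp: continuous_map_def Pi_iff)
  ultimately show ?thesis
    using iota_descend_cont[of "topspace M" Y F] F inv by simp
qed

text \<open>A local section \<open>s\<close> of \<open>Q\<close> yields the chart
  \<open>(u, g) \<mapsto> [s u, g]\<close>. Its coordinate is
  \<open>[q, g] \<mapsto> \<tau> q \<otimes> g\<close>, which is well defined because replacing
  \<open>(q, g)\<close> by \<open>(q a, inv a \<otimes> g)\<close> multiplies
  \<open>\<tau> q\<close> by \<open>a\<close> on the right.\<close>

lemma iota_principal: "principal_bundle G TG M E"
proof (rule G.principal_bundleI[OF iota_bproj_cont])
  fix m assume "m \<in> topspace M"
  then obtain U \<phi> \<tau> where U: "m \<in> U" and c: "bundle_chart K TK M Q U \<phi> \<tau>"
    using K.chart_exists[OF Q] by metis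
  note oneK = subgroup.one_closed[OF t.subgroup_kernel]
  define s where "s = (\<lambda>u. \<phi> (u, \<one>))"
  define F where "F = (\<lambda>(q, g). \<tau> q \<otimes> g)"
  define \<Phi> where "\<Phi> = (\<lambda>(u, g). balanced_class Q (s u) g)"
  define \<T> where "\<T> = (\<lambda>c. the_elem (F ` c))"
  have s: "s u \<in> topspace (total Q)" "bproj Q (s u) = u" "\<tau> (s u) = \<one>" if "u \<in> U" for u
    using chart_mem[OF c K.topspace_eq that] chart_proj[OF c that] chart_coord[OF c that] oneK
    by (auto simp: s_def)
  have \<tau>K: "\<tau> q \<in> G1" if "q \<in> topspace (total Q)" "bproj Q q \<in> U" for q
    using chart_coord_closed[OF c K.topspace_eq that] by simp
  have s\<tau>: "ract Q (s (bproj Q q)) (\<tau> q) = q" if "q \<in> topspace (total Q)" "bproj Q q \<in> U" for q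
    using chart_mult[OF c that(2), of \<one> "\<tau> q"] chart_inverse[OF c that] \<tau>K[OF that] oneK kernel_closed
    by (simp add: s_def)
  have Finv: "F (ract Q q a, inv a \<otimes> g) = F (q, g)"
    if "q \<in> topspace (total Q)" "bproj Q q \<in> U" "g \<in> carrier G" "a \<in> G1" for q g a
  proof -
    have "\<tau> (ract Q q a) = \<tau> q \<otimes> a" using K.chart_coord_mult[OF c that(1,2)] that by simp
    moreover have "a \<otimes> (inv a \<otimes> g) = g" using that kernel_closed by (simp flip: G.m_assoc)
    ultimately show ?thesis using \<tau>K[OF that(1,2)] that kernel_closed by (simp add: F_def G.m_assoc)
  qed
  have \<T>: "\<T> (balanced_class Q q g) = \<tau> q \<otimes> g"
    if "q \<in> topspace (total Q)" "bproj Q q \<in> U" "g \<in> carrier G" for q g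
    using the_elem_balanced_class[OF that(1,3), of F] Finv that by (simp add: \<T>_def F_def)
  have sc: "continuous_map (subtopology M U) (total Q) s"
    unfolding s_def
    by (rule continuous_map_comp[OF _ chart_cont[OF c]]) (use oneK in \<open>simp add: continuous_map_paired G.topspace_eq\<close>)
  have "bundle_chart G TG M E U \<Phi> \<T>"
    unfolding bundle_chart_def
  proof (intro conjI ballI impI)
    show "openin M U" using chart_open[OF c] .
    show "continuous_map (prod_topology (subtopology M U) TG) (total E) \<Phi>"
      unfolding \<Phi>_def case_prod_unfold
      by (intro iota_class_cont continuous_map_comp[OF continuous_map_fst sc] continuous_map_snd)
    show "continuous_map (subtopology (total E) {p \<in> topspace (total E). bproj E p \<in> U}) TG \<T>"
      unfolding \<T>_def
    proof (rule iota_descend_cont[OF chart_open[OF c] _ Finv])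
      show "continuous_map (prod_topology (subtopology (total Q) {q \<in> topspace (total Q). bproj Q q \<in> U}) TG) TG F"
        unfolding F_def case_prod_unfold
        using chart_coord_cont[OF c]
        by (intro G.continuous_map_mult_of continuous_map_comp[OF continuous_map_fst] continuous_map_snd)
          (rule continuous_map_into_fulltopology)
    qed
    show "bproj E (\<Phi> (u, g)) = u" "\<T> (\<Phi> (u, g)) = g" if "u \<in> U" "g \<in> carrier G" for u g
      using s[OF that(1)] that by (auto simp: \<Phi>_def iota_bproj \<T>)
    show "\<Phi> (bproj E p, \<T> p) = p" if p: "p \<in> topspace (total E)" "bproj E p \<in> U" for p
    proof -
      obtain q g where q: "q \<in> topspace (total Q)" "g \<in> carrier G" "p = balanced_class Q q g"
        using p(1) by (rule iota_cases)
      then have b: "bproj Q q \<in> U" using p by (simp add: iota_bproj)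
      then have "\<Phi> (bproj E p, \<T> p) = balanced_class Q (s (bproj Q q)) (\<tau> q \<otimes> g)"
        using q by (simp add: \<Phi>_def iota_bproj \<T>)
      \<comment> \<open>As \<open>q\<close> is the section value moved by \<open>\<tau> q\<close>,
        the factor \<open>\<tau> q\<close> can be passed from the group component back to the bundle
        component.\<close>
      also have "\<dots> = balanced_class Q q g"
        using balanced_class_shift[OF s(1)[OF b] \<tau>K[OF q(1) b] q(2)] s\<tau>[OF q(1) b] by simp
      finally show ?thesis using q by simp
    qed
    show "\<Phi> (u, g \<otimes> g') = ract E (\<Phi> (u, g)) g'"
      if "u \<in> U" "g \<in> carrier G" "g' \<in> carrier G" for u g g'
      using s[OF that(1)] that by (simp add: \<Phi>_def iota_ract)
  qed
  then show "\<exists>U \<phi> \<tau>. m \<in> U \<and> bundle_chart G TG M E U \<phi> \<tau>" using U by blast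
qed

lemma iota_bibundle: "bibundle G TG H TH t M E"
  unfolding bibundle_def
proof (intro conjI ballI)
  show "principal_bundle G TG M E" by (rule iota_principal)
  show "continuous_map (total E) TH (str E)"
  proof (rule continuous_compose_quotient_map[OF iota_quotient])
    show "continuous_map (prod_topology (total Q) TG) TH (str E \<circ> (\<lambda>(q, g). balanced_class Q q g))"
      by (rule continuous_map_eq[OF continuous_map_comp[OF continuous_map_snd t_continuous]])
        (auto simp: iota_str G.topspace_eq)
  qed
  show "str E (ract E p g) = str E p \<otimes>\<^bsub>H\<^esub> t g" if "p \<in> topspace (total E)" "g \<in> carrier G" for p g
    using that(1) by (rule iota_cases) (use that in \<open>simp add: iota_ract iota_str\<close>)
qed

text \<open>A map into \<open>str P = 1\<close> extends along \<open>q \<mapsto> [q, 1]\<close> to a bundle morphism, which is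
  automatically invertible.\<close>

lemma iota_isomorphicI:
  fixes P :: "('p, 'm, 'g, 'h) bibundle"
  assumes P: "bibundle G TG H TH t M P"
    and j: "continuous_map (total Q) (total P) j"
    and jproj: "\<And>q. q \<in> topspace (total Q) \<Longrightarrow> bproj P (j q) = bproj Q q"
    and jact: "\<And>q a. q \<in> topspace (total Q) \<Longrightarrow> a \<in> G1 \<Longrightarrow> j (ract Q q a) = ract P (j q) a"
    and jstr: "\<And>q. q \<in> topspace (total Q) \<Longrightarrow> str P (j q) = \<one>\<^bsub>H\<^esub>"
  shows "bibundle_isomorphic G E P"
proof -
  have prin: "principal_bundle G TG M P"
    and strP: "\<And>p g. p \<in> topspace (total P) \<Longrightarrow> g \<in> carrier G \<Longrightarrow> str P (ract P p g) = str P p \<otimes>\<^bsub>H\<^esub> t g"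
    using P by (auto simp: bibundle_def)
  have jmem: "j q \<in> topspace (total P)" if "q \<in> topspace (total Q)" for q
    using j that by (auto simp: continuous_map_def Pi_iff)
  \<comment> \<open>Since \<open>[q, g] = [q, \<one>] g\<close>, equivariance forces
    \<open>[q, g]\<close> to go to \<open>j q\<close> moved by \<open>g\<close>.\<close>
  define F where "F = (\<lambda>(q, g). ract P (j q) g)"
  define f where "f = (\<lambda>c. the_elem (F ` c))"
  have Finv: "F (ract Q q a, inv a \<otimes> g) = F (q, g)"
    if "q \<in> topspace (total Q)" "g \<in> carrier G" "a \<in> G1" for q g a
  proof -
    have "a \<otimes> (inv a \<otimes> g) = g" using that kernel_closed by (simp flip: G.m_assoc)
    then show ?thesis using that jmem kernel_closed by (simp add: F_def jact G.ract_ract[OF prin])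
  qed
  have f: "f (balanced_class Q q g) = ract P (j q) g" if "q \<in> topspace (total Q)" "g \<in> carrier G" for q g
    using the_elem_balanced_class[OF that, of F] Finv that by (simp add: f_def F_def)
  have "bundle_iso G E P f"
  proof (rule G.bundle_morphism_iso[OF iota_principal prin])
    show "continuous_map (total E) (total P) f"
      unfolding f_def
    proof (rule iota_descend_cont_total[OF _ Finv])
      show "continuous_map (prod_topology (total Q) TG) (total P) F"
        unfolding F_def case_prod_unfold
        by (intro G.ract_cont_of[OF prin] continuous_map_comp[OF continuous_map_fst j] continuous_map_snd)
    qed
    show "bproj P (f p) = bproj E p" if "p \<in> topspace (total E)" for p
      using that by (rule iota_cases) (simp add: f iota_bproj G.bproj_ract[OF prin] jmem jproj)
    show "f (ract E p g) = ract P (f p) g" if "p \<in> topspace (total E)" "g \<in> carrier G" for p g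
      using that(1) by (rule iota_cases) (use that in \<open>simp add: f iota_ract G.ract_ract[OF prin] jmem\<close>)
  qed
  moreover have "str P (f p) = str E p" if "p \<in> topspace (total E)" for p
    using that by (rule iota_cases) (simp add: f iota_str strP jmem jstr)
  ultimately show ?thesis unfolding bibundle_isomorphic_def by blast
qed

end

end

section \<open>Isomorphism classes\<close>

context topological_group
begin

text \<open>The extra facts about \<open>h\<close> allow a condition on \<open>f\<close>, such as
  compatibility with structure maps, to be turned into the same condition on
  \<open>h\<close>.\<close>

lemma bundle_iso_inverse:
  fixes P :: "('p, 'm, 'a, 'z) pbundle_scheme" and Q :: "('q, 'm, 'a, 'w) pbundle_scheme"
  assumes P: "principal_bundle G T M P" and f: "bundle_iso G P Q f"
  obtains h where "bundle_iso G Q P h"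
    and "\<And>q. q \<in> topspace (total Q) \<Longrightarrow> h q \<in> topspace (total P)"
    and "\<And>q. q \<in> topspace (total Q) \<Longrightarrow> f (h q) = q"
proof -
  obtain h where hm: "homeomorphic_maps (total P) (total Q) f h"
    using f by (auto simp: bundle_iso_def homeomorphic_map_maps)
  then have hf: "\<And>p. p \<in> topspace (total P) \<Longrightarrow> h (f p) = p"
    and fh: "\<And>q. q \<in> topspace (total Q) \<Longrightarrow> f (h q) = q"
    and hmem: "\<And>q. q \<in> topspace (total Q) \<Longrightarrow> h q \<in> topspace (total P)"
    by (auto simp: homeomorphic_maps_def continuous_map_def Pi_iff)
  have fproj: "\<And>p. p \<in> topspace (total P) \<Longrightarrow> bproj Q (f p) = bproj P p"
    and fact: "\<And>p g. p \<in> topspace (total P) \<Longrightarrow> g \<in> carrier G \<Longrightarrow> f (ract P p g) = ract Q (f p) g"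
    using f by (auto simp: bundle_iso_def)
  have "bundle_iso G Q P h"
    unfolding bundle_iso_def
  proof (intro conjI ballI)
    show "homeomorphic_map (total Q) (total P) h" using hm by (simp add: homeomorphic_maps_map)
    show "bproj P (h q) = bproj Q q" if "q \<in> topspace (total Q)" for q
      using fproj[OF hmem[OF that]] fh[OF that] by simp
    show "h (ract Q q g) = ract P (h q) g" if "q \<in> topspace (total Q)" "g \<in> carrier G" for q g
      using fact[OF hmem[OF that(1)] that(2)] fh[OF that(1)]
        hf[OF ract_mem[OF P hmem[OF that(1)] that(2)]] by simp
  qed
  then show thesis using that hmem fh by blast
qed

end

lemma bundle_iso_comp:
  assumes f: "bundle_iso G P Q f" and h: "bundle_iso G Q R h"
  shows "bundle_iso G P R (\<lambda>p. h (f p))"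
proof -
  have "f p \<in> topspace (total Q)" if "p \<in> topspace (total P)" for p
    using f that homeomorphic_imp_surjective_map by (fastforce simp: bundle_iso_def)
  moreover have "homeomorphic_map (total P) (total R) (\<lambda>p. h (f p))"
    using homeomorphic_map_compose[of "total P" "total Q" f "total R" h] f h
    by (simp add: bundle_iso_def comp_def)
  ultimately show ?thesis using f h by (simp add: bundle_iso_def)
qed

lemma bibundle_isomorphic_trans:
  assumes "bibundle_isomorphic G P Q" "bibundle_isomorphic G Q R"
  shows "bibundle_isomorphic G P R"
proof -
  obtain f h where f: "bundle_iso G P Q f" "\<forall>p \<in> topspace (total P). str Q (f p) = str P p"
    and h: "bundle_iso G Q R h" "\<forall>p \<in> topspace (total Q). str R (h p) = str Q p"
    using assms by (auto simp: bibundle_isomorphic_def)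
  have "f p \<in> topspace (total Q)" if "p \<in> topspace (total P)" for p
    using f that homeomorphic_imp_surjective_map by (fastforce simp: bundle_iso_def)
  then have "\<forall>p \<in> topspace (total P). str R (h (f p)) = str P p" using f h by simp
  then show ?thesis using bundle_iso_comp[OF f(1) h(1)] by (auto simp: bibundle_isomorphic_def)
qed

lemma bundle_isomorphic_trans:
  "bundle_isomorphic G P Q \<Longrightarrow> bundle_isomorphic G Q R \<Longrightarrow> bundle_isomorphic G P R"
  unfolding bundle_isomorphic_def using bundle_iso_comp by blast

context topological_group
begin

lemma bundle_isomorphic_sym:
  "principal_bundle G T M P \<Longrightarrow> bundle_isomorphic G P Q \<Longrightarrow> bundle_isomorphic G Q P"
  unfolding bundle_isomorphic_def using bundle_iso_inverse by metis

lemma bibundle_isomorphic_sym: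
  assumes "bibundle G T H TH t M P" "bibundle_isomorphic G P Q"
  shows "bibundle_isomorphic G Q P"
proof -
  obtain f where f: "bundle_iso G P Q f" "\<forall>p \<in> topspace (total P). str Q (f p) = str P p"
    using assms by (auto simp: bibundle_isomorphic_def)
  have "principal_bundle G T M P" using assms by (simp add: bibundle_def)
  then obtain h where "bundle_iso G Q P h"
    and "\<And>q. q \<in> topspace (total Q) \<Longrightarrow> h q \<in> topspace (total P)"
    and "\<And>q. q \<in> topspace (total Q) \<Longrightarrow> f (h q) = q"
    using f(1) by (rule bundle_iso_inverse) (rule that)
  then show ?thesis using f(2) unfolding bibundle_isomorphic_def by metis
qed

text \<open>\<open>P\<close> may live on another type and then is no member of its own class. From
  left to right, a copy of \<open>P\<close> on \<open>'m \<times> 'g\<close> is the member that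
  links the two bundles.\<close>

lemma bundle_class_eq_iff:
  fixes P :: "('p, 'm, 'a) pbundle" and Q :: "('q, 'm, 'a) pbundle"
  assumes P: "principal_bundle G T M P" and Q: "principal_bundle G T M Q"
  shows "bundle_class G T M P = bundle_class G T M Q \<longleftrightarrow> bundle_isomorphic G P Q"
proof
  assume eq: "bundle_class G T M P = bundle_class G T M Q"
  obtain P' :: "('m \<times> 'a, 'm, 'a) pbundle"
    where P': "principal_bundle G T M P'" "bundle_isomorphic G P P'"
    using bundle_representable[OF is_group topspace_eq P] by blast
  then have "P' \<in> bundle_class G T M P" using P by (auto simp: bundle_class_def intro: bundle_isomorphic_sym)
  then have "bundle_isomorphic G P' Q" unfolding eq by (simp add: bundle_class_def)
  then show "bundle_isomorphic G P Q" using P' bundle_isomorphic_trans by blast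
next
  assume PQ: "bundle_isomorphic G P Q"
  have QP: "bundle_isomorphic G Q P" using P PQ by (rule bundle_isomorphic_sym)
  show "bundle_class G T M P = bundle_class G T M Q"
    unfolding bundle_class_def
    by (auto intro: bundle_isomorphic_trans[OF _ PQ] bundle_isomorphic_trans[OF _ QP])
qed

lemma bibundle_class_eq_iff:
  fixes P :: "('p, 'm, 'a, 'h) bibundle" and Q :: "('q, 'm, 'a, 'h) bibundle"
  assumes P: "bibundle G T H TH t M P" and Q: "bibundle G T H TH t M Q"
  shows "bibundle_class G T H TH t M P = bibundle_class G T H TH t M Q \<longleftrightarrow> bibundle_isomorphic G P Q"
proof
  assume eq: "bibundle_class G T H TH t M P = bibundle_class G T H TH t M Q"
  obtain P' :: "('m \<times> 'a, 'm, 'a, 'h) bibundle"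
    where P': "bibundle G T H TH t M P'" "bibundle_isomorphic G P P'"
    using bibundle_representable[OF is_group topspace_eq P] by blast
  then have "P' \<in> bibundle_class G T H TH t M P"
    using P by (auto simp: bibundle_class_def intro: bibundle_isomorphic_sym)
  then have "bibundle_isomorphic G P' Q" unfolding eq by (simp add: bibundle_class_def)
  then show "bibundle_isomorphic G P Q" using P' bibundle_isomorphic_trans by blast
next
  assume PQ: "bibundle_isomorphic G P Q"
  have QP: "bibundle_isomorphic G Q P" using P PQ by (rule bibundle_isomorphic_sym)
  show "bibundle_class G T H TH t M P = bibundle_class G T H TH t M Q"
    unfolding bibundle_class_def
    by (auto intro: bibundle_isomorphic_trans[OF _ PQ] bibundle_isomorphic_trans[OF _ QP])
qed

text \<open>Needed for \<open>iota\<close>, whose total space consists of sets of pairs: its class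
  is also the class of a copy on \<open>'m \<times> 'g\<close>.\<close>

lemma bibundle_class_mem_pi0:
  fixes P :: "('p, 'm, 'a, 'h) bibundle"
  assumes P: "bibundle G T H TH t M P"
  shows "bibundle_class G T H TH t M P \<in> fst (pi0_Bibun G T H TH t M)"
proof -
  obtain P' :: "('m \<times> 'a, 'm, 'a, 'h) bibundle"
    where P': "bibundle G T H TH t M P'" "bibundle_isomorphic G P P'"
    using bibundle_representable[OF is_group topspace_eq P] by blast
  then show ?thesis using bibundle_class_eq_iff[OF P P'(1)] by (auto simp: pi0_Bibun_def)
qed

lemma trivial_bundle_principal: "principal_bundle G T M (trivial_bundle G T M)"
proof (rule principal_bundleI)
  show "continuous_map (total (trivial_bundle G T M)) M (bproj (trivial_bundle G T M))"
    by (simp add: trivial_bundle_def continuous_map_fst)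
  have "continuous_map (subtopology (prod_topology M T) X) T snd" for X
    by (simp add: continuous_map_from_subtopology continuous_map_snd)
  then have "bundle_chart G T M (trivial_bundle G T M) (topspace M) (\<lambda>x. x) snd"
    unfolding bundle_chart_def by (auto simp: trivial_bundle_def)
  then show "\<exists>U \<phi> \<tau>. m \<in> U \<and> bundle_chart G T M (trivial_bundle G T M) U \<phi> \<tau>" if "m \<in> topspace M" for m
    using that by blast
qed

end

section \<open>Functoriality of the associated bibundle and types\<close>

context crossed_module
begin

lemma trivial_bibundle_bibundle: "bibundle G TG H TH t M (trivial_bibundle G TG t M)"
  unfolding bibundle_def
proof (intro conjI ballI)
  \<comment> \<open>The two records agree in total space, projection and action, and charts refer to
    nothing else.\<close>
  have "bundle_chart G TG M (trivial_bibundle G TG t M) U \<phi> \<tau> \<longleftrightarrow>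
      bundle_chart G TG M (trivial_bundle G TG M) U \<phi> \<tau>" for U \<phi> \<tau>
    by (simp add: bundle_chart_def trivial_bundle_def trivial_bibundle_def)
  note [simp] = this
  have "\<exists>U \<phi> \<tau>. m \<in> U \<and> bundle_chart G TG M (trivial_bibundle G TG t M) U \<phi> \<tau>"
    if "m \<in> topspace M" for m
    by (rule G.chart_exists[OF G.trivial_bundle_principal that]) auto
  then show "principal_bundle G TG M (trivial_bibundle G TG t M)"
    by (rule G.principal_bundleI[rotated]) (simp_all add: trivial_bibundle_def continuous_map_fst)
  show "continuous_map (total (trivial_bibundle G TG t M)) TH (str (trivial_bibundle G TG t M))"
    using continuous_map_comp[OF continuous_map_snd t_continuous, of M]
    by (simp add: trivial_bibundle_def case_prod_unfold)
qed (auto simp: trivial_bibundle_def G.topspace_eq)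

text \<open>The map \<open>q \<mapsto> [f q, \<one>]\<close> has structure value 1 and is
  equivariant because \<open>[(f q) a, \<one>] = [f q, a] = [f q, \<one>] a\<close>; so it extends
  to an isomorphism by \<open>iota_isomorphicI\<close>.\<close>

lemma iota_isomorphic:
  fixes Q :: "('q, 'm, 'g) pbundle" and Q' :: "('r, 'm, 'g) pbundle"
  assumes Q: "principal_bundle K TK M Q" and Q': "principal_bundle K TK M Q'"
    and iso: "bundle_isomorphic K Q Q'"
  shows "bibundle_isomorphic G (iota G TG G1 t Q) (iota G TG G1 t Q')"
proof -
  obtain f where f: "bundle_iso K Q Q' f" using iso by (auto simp: bundle_isomorphic_def)
  then have fc: "continuous_map (total Q) (total Q') f"
    and fproj: "\<And>q. q \<in> topspace (total Q) \<Longrightarrow> bproj Q' (f q) = bproj Q q"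
    and fact: "\<And>q a. q \<in> topspace (total Q) \<Longrightarrow> a \<in> G1 \<Longrightarrow> f (ract Q q a) = ract Q' (f q) a"
    by (auto simp: bundle_iso_def homeomorphic_imp_continuous_map)
  have fmem: "f q \<in> topspace (total Q')" if "q \<in> topspace (total Q)" for q
    using fc that by (auto simp: continuous_map_def Pi_iff)
  show ?thesis
  proof (rule iota_isomorphicI[OF Q iota_bibundle[OF Q'], where j = "\<lambda>q. balanced_class Q' (f q) \<one>"])
    show "continuous_map (total Q) (total (iota G TG G1 t Q')) (\<lambda>q. balanced_class Q' (f q) \<one>)"
      by (intro iota_class_cont[OF Q'] fc) (simp add: G.topspace_eq)
    show "bproj (iota G TG G1 t Q') (balanced_class Q' (f q) \<one>) = bproj Q q" if "q \<in> topspace (total Q)" for q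
      using that by (simp add: iota_bproj[OF Q'] fmem fproj)
    show "balanced_class Q' (f (ract Q q a)) \<one> = ract (iota G TG G1 t Q') (balanced_class Q' (f q) \<one>) a"
      if "q \<in> topspace (total Q)" "a \<in> G1" for q a
      using that by (simp add: fact iota_ract[OF Q'] fmem kernel_closed balanced_class_shift[OF Q'])
    show "str (iota G TG G1 t Q') (balanced_class Q' (f q) \<one>) = \<one>\<^bsub>H\<^esub>" if "q \<in> topspace (total Q)" for q
      using that by (simp add: iota_str[OF Q'] fmem)
  qed
qed

text \<open>The inclusion of \<open>M \<times> G1\<close> into \<open>M \<times> G\<close> is an
  equivariant map into the locus of structure value 1.\<close>

lemma iota_trivial:
  "bibundle_isomorphic G (iota G TG G1 t (trivial_bundle K TK M)) (trivial_bibundle G TG t M)"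
proof (rule iota_isomorphicI[OF K.trivial_bundle_principal trivial_bibundle_bibundle, where j = "\<lambda>x. x"])
  show "continuous_map (total (trivial_bundle K TK M)) (total (trivial_bibundle G TG t M)) (\<lambda>x. x)"
    using continuous_map_from_subtopology[OF continuous_map_id[of "prod_topology M TG"], of "topspace M \<times> G1"]
    by (simp add: trivial_bundle_def trivial_bibundle_def prod_topology_subtopology id_def)
qed (auto simp: trivial_bundle_def trivial_bibundle_def t_kernel)

lemma iota_reflects_trivial:
  fixes Q :: "('q, 'm, 'g) pbundle"
  assumes Q: "principal_bundle K TK M Q"
    and iso: "bibundle_isomorphic G (iota G TG G1 t Q) (trivial_bibundle G TG t M)"
  shows "bundle_isomorphic K Q (trivial_bundle K TK M)"
proof -
  let ?E = "iota G TG G1 t Q"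
  obtain f where f: "bundle_iso G ?E (trivial_bibundle G TG t M) f"
    and fstr: "\<forall>c \<in> topspace (total ?E). str (trivial_bibundle G TG t M) (f c) = str ?E c"
    using iso by (auto simp: bibundle_isomorphic_def)
  have fc: "continuous_map (total ?E) (prod_topology M TG) f"
    and fproj: "\<And>c. c \<in> topspace (total ?E) \<Longrightarrow> fst (f c) = bproj ?E c"
    and fact: "\<And>c g. c \<in> topspace (total ?E) \<Longrightarrow> g \<in> carrier G \<Longrightarrow>
      f (ract ?E c g) = (fst (f c), snd (f c) \<otimes> g)"
    using f homeomorphic_imp_continuous_map
    by (fastforce simp: bundle_iso_def trivial_bibundle_def case_prod_unfold)+
  define j where "j = (\<lambda>q. f (balanced_class Q q \<one>))"
  have cmem: "balanced_class Q q \<one> \<in> topspace (total ?E)" if "q \<in> topspace (total Q)" for q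
    using iota_class_mem[OF Q that] by simp
  have jc: "continuous_map (total Q) (prod_topology M TG) j"
    unfolding j_def
    by (rule continuous_map_comp[OF iota_class_cont[OF Q] fc]) (simp_all add: G.topspace_eq)
  \<comment> \<open>Here compatibility of \<open>f\<close> with the structure maps enters:
    \<open>[q, \<one>]\<close> has structure value \<open>t \<one> = \<one>\<close>, so the group
    component of \<open>j q\<close> lies in the kernel. A mere isomorphism of
    \<open>G\<close>-bundles need not have this property.\<close>
  have j1: "snd (j q) \<in> G1" if "q \<in> topspace (total Q)" for q
  proof (rule kernelI)
    show "snd (j q) \<in> carrier G"
      using jc that by (fastforce simp: continuous_map_def Pi_iff G.topspace_eq)
    have "t (snd (j q)) = str ?E (balanced_class Q q \<one>)"
      using bspec[OF fstr cmem[OF that]] by (simp add: j_def trivial_bibundle_def case_prod_unfold)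
    then show "t (snd (j q)) = \<one>\<^bsub>H\<^esub>" using that by (simp add: iota_str[OF Q])
  qed
  have "bundle_iso K Q (trivial_bundle K TK M) j"
  proof (rule K.bundle_morphism_iso[OF Q K.trivial_bundle_principal])
    show "continuous_map (total Q) (total (trivial_bundle K TK M)) j"
      using continuous_map_fst_of[OF jc] continuous_map_snd_of[OF jc] j1
      by (auto simp: trivial_bundle_def continuous_map_pairwise continuous_map_in_subtopology)
    show "bproj (trivial_bundle K TK M) (j q) = bproj Q q" if "q \<in> topspace (total Q)" for q
      using that by (simp add: trivial_bundle_def j_def fproj cmem iota_bproj[OF Q])
    show "j (ract Q q a) = ract (trivial_bundle K TK M) (j q) a"
      if "q \<in> topspace (total Q)" "a \<in> carrier K" for q a
    proof -
      have a: "a \<in> G1" using that by simp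
      have "balanced_class Q (ract Q q a) \<one> = ract ?E (balanced_class Q q \<one>) a"
        using that a kernel_closed by (simp add: balanced_class_shift[OF Q] iota_ract[OF Q])
      then show ?thesis
        using fact[OF cmem[OF that(1)] kernel_closed[OF a]]
        by (simp add: j_def trivial_bundle_def case_prod_unfold)
    qed
  qed
  then show ?thesis by (auto simp: bundle_isomorphic_def)
qed

text \<open>Cosets are taken on the right, while \<open>t g\<close> multiplies \<open>h\<close> on
  the right. The identity \<open>h \<otimes> t g = t (\<alpha> h g) \<otimes> h\<close> from
  \<open>equivariant\<close> moves the factor next to the subgroup, which absorbs it.\<close>

lemma coset_mult_image:
  assumes h: "h \<in> carrier H" and g: "g \<in> carrier G"
  shows "t ` carrier G #>\<^bsub>H\<^esub> (h \<otimes>\<^bsub>H\<^esub> t g) = t ` carrier G #>\<^bsub>H\<^esub> h"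
proof -
  have "\<alpha> h \<in> hom G G"
    using hom_in_carrier[OF action_hom h] by (simp add: TopAut_def auto_def)
  then have \<alpha>: "\<alpha> h g \<in> carrier G" using g by (rule hom_in_carrier)
  have "t (\<alpha> h g) \<otimes>\<^bsub>H\<^esub> h = h \<otimes>\<^bsub>H\<^esub> t g"
    using h g by (simp add: equivariant H.m_assoc)
  then have "t ` carrier G #>\<^bsub>H\<^esub> (h \<otimes>\<^bsub>H\<^esub> t g) = (t ` carrier G #>\<^bsub>H\<^esub> t (\<alpha> h g)) #>\<^bsub>H\<^esub> h"
    using H.coset_mult_assoc[of "t ` carrier G" "t (\<alpha> h g)" h] \<alpha> h by (simp add: image_subset_iff)
  also have "t ` carrier G #>\<^bsub>H\<^esub> t (\<alpha> h g) = t ` carrier G"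
    using \<alpha> t.img_is_subgroup by (intro H.coset_join2) auto
  finally show ?thesis .
qed

section \<open>The structure map and the type of a single bibundle\<close>

context
  fixes M and P :: "('p, 'm, 'g, 'h) bibundle"
  assumes P: "bibundle G TG H TH t M P"
begin

lemma bibundle_principal: "principal_bundle G TG M P"
  and str_cont: "continuous_map (total P) TH (str P)"
  and str_ract: "p \<in> topspace (total P) \<Longrightarrow> g \<in> carrier G \<Longrightarrow> str P (ract P p g) = str P p \<otimes>\<^bsub>H\<^esub> t g"
  using P by (auto simp: bibundle_def)

lemma str_mem: "p \<in> topspace (total P) \<Longrightarrow> str P p \<in> carrier H"
  using str_cont by (auto simp: continuous_map_def Pi_iff H.topspace_eq)

lemma type_map_eq:
  assumes p: "p \<in> topspace (total P)"
  shows "type_map G H t M P (bproj P p) = t ` carrier G #>\<^bsub>H\<^esub> str P p"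
proof -
  have eq: "t ` carrier G #>\<^bsub>H\<^esub> str P p' = t ` carrier G #>\<^bsub>H\<^esub> str P p"
    if p': "p' \<in> topspace (total P)" "bproj P p' = bproj P p" for p'
  proof -
    obtain g where "g \<in> carrier G" "ract P p g = p'"
      by (rule G.ract_transitive[OF bibundle_principal p p'(1) p'(2)[symmetric]])
    then show ?thesis using str_ract[OF p] coset_mult_image[OF str_mem[OF p]] by auto
  qed
  have "the_elem ((\<lambda>p. t ` carrier G #>\<^bsub>H\<^esub> str P p) ` {p' \<in> topspace (total P). bproj P p' = bproj P p})
      = t ` carrier G #>\<^bsub>H\<^esub> str P p"
    by (rule the_elem_image_unique) (use p in blast, use eq in blast)
  then show ?thesis using G.bproj_mem[OF bibundle_principal p] by (simp add: type_map_def)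
qed

lemma fibre_point:
  assumes "m \<in> topspace M"
  obtains p where "p \<in> topspace (total P)" "bproj P p = m"
proof -
  obtain U \<phi> \<tau> where "m \<in> U" "bundle_chart G TG M P U \<phi> \<tau>"
    using G.chart_exists[OF bibundle_principal assms] by metis
  then show thesis
    using that[of "\<phi> (m, \<one>)"] chart_mem[of G TG M P U \<phi> \<tau> m \<one>] chart_proj[of G TG M P U \<phi> \<tau> m \<one>] G.topspace_eq by simp
qed

lemma type_map_extensional: "type_map G H t M P \<in> extensional (topspace M)"
  by (simp add: type_map_def)

text \<open>Over a chart the type is a section of \<open>P\<close>, followed by \<open>str P\<close>
  and the coset projection.\<close>

lemma type_map_continuous: "continuous_map M (coset_topology H TH (t ` carrier G)) (type_map G H t M P)"
proof (rule continuous_map_locally)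
  fix m assume "m \<in> topspace M"
  then obtain U \<phi> \<tau> where U: "m \<in> U" and c: "bundle_chart G TG M P U \<phi> \<tau>"
    using G.chart_exists[OF bibundle_principal] by metis
  have s: "\<phi> (u, \<one>) \<in> topspace (total P)" "bproj P (\<phi> (u, \<one>)) = u" if "u \<in> U" for u
    using chart_mem[OF c G.topspace_eq that] chart_proj[OF c that] by auto
  have "continuous_map (subtopology M U) (prod_topology (subtopology M U) TG) (\<lambda>u. (u, \<one>))"
    by (simp add: continuous_map_paired G.topspace_eq)
  from continuous_map_comp[OF continuous_map_comp[OF this chart_cont[OF c]] str_cont]
  have sc: "continuous_map (subtopology M U) TH (\<lambda>u. str P (\<phi> (u, \<one>)))" .
  have qc: "continuous_map TH (coset_topology H TH (t ` carrier G)) (\<lambda>h. t ` carrier G #>\<^bsub>H\<^esub> h)"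
    unfolding coset_topology_def by (rule quotient_imp_continuous_map[OF quotient_map_quotient_topology])
  have "continuous_map (subtopology M U) (coset_topology H TH (t ` carrier G)) (type_map G H t M P)"
    by (rule continuous_map_eq[OF continuous_map_comp[OF sc qc]]) (use s type_map_eq in fastforce)
  then show "\<exists>U. openin M U \<and> m \<in> U \<and>
      continuous_map (subtopology M U) (coset_topology H TH (t ` carrier G)) (type_map G H t M P)"
    using chart_open[OF c] U by blast
qed

text \<open>The unit of \<open>H Mod N\<close> is the coset \<open>N\<close> itself, and
  \<open>N #> h = N\<close> exactly for \<open>h\<close> in \<open>N\<close>. This is the form in
  which trivial type enters the reduction.\<close>

lemma type_map_eq_one_iff:
  "type_map G H t M P = const_one M (H Mod (t ` carrier G)) \<longleftrightarrow>
   (\<forall>p \<in> topspace (total P). str P p \<in> t ` carrier G)"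
proof
  assume eq: "type_map G H t M P = const_one M (H Mod (t ` carrier G))"
  show "\<forall>p \<in> topspace (total P). str P p \<in> t ` carrier G"
  proof
    fix p assume p: "p \<in> topspace (total P)"
    then have "t ` carrier G #>\<^bsub>H\<^esub> str P p = t ` carrier G"
      using type_map_eq[OF p] G.bproj_mem[OF bibundle_principal p] by (simp add: eq const_one_def)
    then show "str P p \<in> t ` carrier G"
      using H.coset_join1 str_mem[OF p] t.img_is_subgroup by blast
  qed
next
  assume R: "\<forall>p \<in> topspace (total P). str P p \<in> t ` carrier G"
  show "type_map G H t M P = const_one M (H Mod (t ` carrier G))"
  proof (rule extensionalityI[OF type_map_extensional])
    show "const_one M (H Mod (t ` carrier G)) \<in> extensional (topspace M)" by (simp add: const_one_def)
    fix m assume m: "m \<in> topspace M"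
    then obtain p where p: "p \<in> topspace (total P)" "bproj P p = m" by (rule fibre_point)
    have "t ` carrier G #>\<^bsub>H\<^esub> str P p = t ` carrier G"
      by (intro H.coset_join2 str_mem[OF p(1)] t.img_is_subgroup bspec[OF R p(1)])
    then show "type_map G H t M P m = const_one M (H Mod (t ` carrier G)) m"
      using type_map_eq[OF p(1)] p m by (simp add: const_one_def)
  qed
qed

end

lemma type_map_isomorphic:
  fixes P :: "('p, 'm, 'g, 'h) bibundle" and Q :: "('q, 'm, 'g, 'h) bibundle"
  assumes P: "bibundle G TG H TH t M P" and Q: "bibundle G TG H TH t M Q"
    and iso: "bibundle_isomorphic G P Q"
  shows "type_map G H t M P = type_map G H t M Q"
proof (rule extensionalityI[OF type_map_extensional[OF P] type_map_extensional[OF Q]])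
  fix m assume "m \<in> topspace M"
  then obtain p where p: "p \<in> topspace (total P)" "bproj P p = m" by (rule fibre_point[OF P])
  obtain f where f: "bundle_iso G P Q f" "str Q (f p) = str P p"
    using iso p by (auto simp: bibundle_isomorphic_def)
  then have "f p \<in> topspace (total Q)" "bproj Q (f p) = m"
    using p homeomorphic_imp_surjective_map by (fastforce simp: bundle_iso_def)+
  then show "type_map G H t M P m = type_map G H t M Q m"
    using type_map_eq[OF P p(1)] type_map_eq[OF Q, of "f p"] f p by simp
qed

lemma type_map_iota:
  assumes Q: "principal_bundle K TK M Q"
  shows "type_map G H t M (iota G TG G1 t Q) = const_one M (H Mod (t ` carrier G))"
  unfolding type_map_eq_one_iff[OF iota_bibundle[OF Q]]
  by (auto elim!: iota_cases[OF Q] simp: iota_str[OF Q])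

end

section \<open>Reduction of bibundles of trivial type\<close>

lemma has_local_sections_homeomorphic:
  assumes p: "has_local_sections X Y p" and f: "homeomorphic_map Y Z f"
  shows "has_local_sections X Z (\<lambda>x. f (p x))"
  unfolding has_local_sections_def
proof
  fix z assume z: "z \<in> topspace Z"
  obtain h where h: "continuous_map Y Z f" "continuous_map Z Y h"
    and fh: "\<And>z. z \<in> topspace Z \<Longrightarrow> f (h z) = z" and hf: "\<And>y. y \<in> topspace Y \<Longrightarrow> h (f y) = y"
    using f by (auto simp: homeomorphic_map_maps homeomorphic_maps_def)
  have "h z \<in> topspace Y" using h z by (auto simp: continuous_map_def Pi_iff)
  then obtain U s where U: "openin Y U" "h z \<in> U" and s: "continuous_map (subtopology Y U) X s"
    and ps: "\<forall>u\<in>U. p (s u) = u"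
    using p unfolding has_local_sections_def by blast
  define V where "V = {z \<in> topspace Z. h z \<in> U}"
  have "openin Z V" unfolding V_def using h(2) U(1) by (rule openin_continuous_map_preimage)
  moreover have "continuous_map (subtopology Z V) (subtopology Y U) h"
    using h(2) by (auto simp: continuous_map_in_subtopology continuous_map_from_subtopology V_def)
  then have "continuous_map (subtopology Z V) X (\<lambda>v. s (h v))" using s by (rule continuous_map_comp)
  moreover have "\<forall>v\<in>V. f (p (s (h v))) = v" using ps fh by (simp add: V_def)
  moreover have "z \<in> V" using z U by (simp add: V_def)
  ultimately show "\<exists>U s. openin Z U \<and> z \<in> U \<and> continuous_map (subtopology Z U) X s \<and> (\<forall>u\<in>U. f (p (s u)) = u)"
    by blast
qed

lemma has_local_sections_cong:
  assumes "has_local_sections X Y p" and eq: "\<And>x. x \<in> topspace X \<Longrightarrow> p x = q x"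
  shows "has_local_sections X Y q"
  unfolding has_local_sections_def
proof
  fix y assume "y \<in> topspace Y"
  then obtain U s where U: "openin Y U" "y \<in> U" "continuous_map (subtopology Y U) X s" "\<forall>u\<in>U. p (s u) = u"
    using assms unfolding has_local_sections_def by blast
  moreover have "s u \<in> topspace X" if "u \<in> U" for u
    using U that openin_subset[OF U(1)] by (fastforce simp: continuous_map_def Pi_iff)
  ultimately show "\<exists>U s. openin Y U \<and> y \<in> U \<and> continuous_map (subtopology Y U) X s \<and> (\<forall>u\<in>U. q (s u) = u)"
    using eq by (intro exI[of _ U] exI[of _ s]) metis
qed

context admissible_crossed_module
begin

lemma t_local_sections: "has_local_sections TG (subtopology TH (t ` carrier G)) t"
proof (rule has_local_sections_cong[OF has_local_sections_homeomorphic[OF local_sections_G image_homeomorphic]])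
  fix g assume "g \<in> topspace TG"
  then have g: "g \<in> carrier G" by (simp add: G.topspace_eq)
  have nonempty: "G1 #> g \<noteq> {}" using g t.subgroup_kernel G.rcos_self by blast
  have eq: "t x = t g" if "x \<in> G1 #> g" for x
    using that g kernel_closed t_kernel by (auto simp: r_coset_def)
  from nonempty eq show "the_elem (t ` (G1 #> g)) = t g" by (rule the_elem_image_unique)
qed

definition reduction :: "('p, 'm, 'g, 'h) bibundle \<Rightarrow> ('p, 'm, 'g) pbundle" where
  "reduction P = \<lparr>total = subtopology (total P) {p. str P p = \<one>\<^bsub>H\<^esub>}, bproj = bproj P, ract = ract P\<rparr>"

text \<open>Over a chart of \<open>P\<close> with section \<open>s\<close>, local sections of \<open>t\<close> lift \<open>str P \<circ> s\<close> to a map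
  \<open>c\<close> into \<open>G\<close>, and \<open>s c\<^sup>-\<^sup>1\<close> is a section of the reduction.\<close>

lemma reduction_principal:
  fixes P :: "('p, 'm, 'g, 'h) bibundle"
  assumes P: "bibundle G TG H TH t M P"
    and str: "\<And>p. p \<in> topspace (total P) \<Longrightarrow> str P p \<in> t ` carrier G"
  shows "principal_bundle K TK M (reduction P)"
proof (rule K.principal_bundleI)
  let ?R = "{p. str P p = \<one>\<^bsub>H\<^esub>}"
  note prin = bibundle_principal[OF P]
  show "continuous_map (total (reduction P)) M (bproj (reduction P))"
    using G.bproj_cont[OF prin] by (simp add: reduction_def continuous_map_from_subtopology)
  fix m assume "m \<in> topspace M"
  then obtain U0 \<phi> \<tau> where U0: "m \<in> U0" and c0: "bundle_chart G TG M P U0 \<phi> \<tau>"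
    using G.chart_exists[OF prin] by metis
  define s where "s = (\<lambda>u. \<phi> (u, \<one>))"
  have s0: "s u \<in> topspace (total P)" if "u \<in> U0" for u
    using chart_mem[OF c0 G.topspace_eq that] by (simp add: s_def)
  have "continuous_map (subtopology M U0) (prod_topology (subtopology M U0) TG) (\<lambda>u. (u, \<one>))"
    by (simp add: continuous_map_paired G.topspace_eq)
  from continuous_map_comp[OF continuous_map_comp[OF this chart_cont[OF c0]] str_cont[OF P]]
  have sc: "continuous_map (subtopology M U0) (subtopology TH (t ` carrier G)) (\<lambda>u. str P (s u))"
    using s0 str by (auto simp: continuous_map_in_subtopology s_def)
  have "str P (s m) \<in> topspace (subtopology TH (t ` carrier G))"
    using str[OF s0[OF U0]] str_mem[OF P s0[OF U0]] by (simp add: H.topspace_eq)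
  then obtain V k where V: "openin (subtopology TH (t ` carrier G)) V" "str P (s m) \<in> V"
    and k: "continuous_map (subtopology (subtopology TH (t ` carrier G)) V) TG k" and tk: "\<forall>v\<in>V. t (k v) = v"
    using t_local_sections unfolding has_local_sections_def by blast
  \<comment> \<open>The chart is shrunk until the structure value of the section stays in the domain
    \<open>V\<close> of the local section \<open>k\<close> of \<open>t\<close>.\<close>
  define U where "U = {u \<in> topspace (subtopology M U0). str P (s u) \<in> V}"
  have "openin (subtopology M U0) U"
    unfolding U_def using sc V(1) by (rule openin_continuous_map_preimage)
  then have U: "openin M U" using chart_open[OF c0] openin_trans_full by blast
  have UU0: "U \<subseteq> U0" and mU: "m \<in> U"
    using U0 V(2) chart_subset[OF c0] by (auto simp: U_def)
  have c: "bundle_chart G TG M P U \<phi> \<tau>" using chart_restrict[OF c0 U UU0] .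
  have \<phi>eq: "\<phi> (u, g) = ract P (s u) g" if "u \<in> U" "g \<in> carrier G" for u g
    using chart_mult[OF c that(1) G.one_closed that(2)] that(2) by (simp add: s_def)
  have smem: "s u \<in> topspace (total P)" if "u \<in> U" for u using s0 that UU0 by blast
  define \<kappa> where "\<kappa> = (\<lambda>u. k (str P (s u)))"
  have "continuous_map (subtopology M U) (subtopology (subtopology TH (t ` carrier G)) V) (\<lambda>u. str P (s u))"
    using continuous_map_from_subtopology_mono[OF sc UU0]
    by (subst continuous_map_in_subtopology) (auto simp: U_def)
  then have \<kappa>c: "continuous_map (subtopology M U) TG \<kappa>"
    unfolding \<kappa>_def using k by (rule continuous_map_comp)
  then have \<kappa>G: "\<kappa> u \<in> carrier G" if "u \<in> U" for u
    using that chart_subset[OF c] by (auto simp: continuous_map_def Pi_iff G.topspace_eq)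
  have t\<kappa>: "t (\<kappa> u) = str P (s u)" if "u \<in> U" for u
    using tk that by (simp add: \<kappa>_def U_def)
  \<comment> \<open>The chart based on the corrected section \<open>s u\<close> moved by
    \<open>inv (\<kappa> u)\<close>. Passing from \<open>s\<close> to this section multiplies the
    coordinate \<tau> on the left by \<kappa>, which gives \<open>\<T>\<close>.\<close>
  define \<Phi> where "\<Phi> = (\<lambda>(u, a). \<phi> (u, inv (\<kappa> u) \<otimes> a))"
  define \<T> where "\<T> = (\<lambda>r. \<kappa> (bproj P r) \<otimes> \<tau> r)"
  have \<tau>G: "\<tau> r \<in> carrier G" if "r \<in> topspace (total P)" "bproj P r \<in> U" for r
    using chart_coord_closed[OF c G.topspace_eq that] .
  have \<Phi>mem: "\<Phi> (u, a) \<in> topspace (total P)" "str P (\<Phi> (u, a)) = \<one>\<^bsub>H\<^esub>" if "u \<in> U" "a \<in> G1" for u a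
  proof -
    have aG: "a \<in> carrier G" using that kernel_closed by blast
    then show "\<Phi> (u, a) \<in> topspace (total P)"
      using chart_mem[OF c G.topspace_eq that(1)] \<kappa>G[OF that(1)] by (simp add: \<Phi>_def)
    \<comment> \<open>The structure value of \<open>s u\<close> is \<open>t (\<kappa> u)\<close> by
      choice of \<kappa>, so the correction by \<open>inv (\<kappa> u)\<close> cancels it and leaves
      \<open>t a\<close>.\<close>
    have "str P (\<Phi> (u, a)) = t (\<kappa> u) \<otimes>\<^bsub>H\<^esub> t (inv (\<kappa> u) \<otimes> a)"
      using aG \<kappa>G that by (simp add: \<Phi>_def \<phi>eq str_ract[OF P] smem t\<kappa> del: t.hom_mult t.hom_inv)
    also have "\<dots> = t a" using aG \<kappa>G[OF that(1)]
      by (simp add: inv_mult_cancel del: t.hom_mult t.hom_inv flip: t.hom_mult)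
    finally show "str P (\<Phi> (u, a)) = \<one>\<^bsub>H\<^esub>" using t_kernel[OF that(2)] by simp
  qed
  have \<T>mem: "\<T> r \<in> G1" if r: "r \<in> topspace (total P)" "bproj P r \<in> U" "str P r = \<one>\<^bsub>H\<^esub>" for r
  proof (rule kernelI)
    show "\<T> r \<in> carrier G" using \<tau>G[OF r(1,2)] \<kappa>G[OF r(2)] by (simp add: \<T>_def)
    \<comment> \<open>Again \<open>t (\<kappa> u)\<close> is the structure value of
      \<open>s u\<close>, and \<open>s u\<close> moved by \<open>\<tau> r\<close> is
      \<open>r\<close>; hence \<open>t (\<T> r) = str P r\<close>.\<close>
    have "t (\<T> r) = str P (ract P (s (bproj P r)) (\<tau> r))"
      using \<tau>G[OF r(1,2)] \<kappa>G[OF r(2)] r(2) by (simp add: \<T>_def t\<kappa> str_ract[OF P] smem)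
    then show "t (\<T> r) = \<one>\<^bsub>H\<^esub>"
      using chart_inverse[OF c r(1,2)] \<phi>eq[OF r(2) \<tau>G[OF r(1,2)]] r(3) by simp
  qed
  have "bundle_chart K TK M (reduction P) U \<Phi> \<T>"
    unfolding bundle_chart_def
  proof (intro conjI ballI impI)
    show "openin M U" by fact
    have "continuous_map (prod_topology (subtopology M U) TK) (prod_topology (subtopology M U) TG)
        (\<lambda>x. (fst x, inv (\<kappa> (fst x)) \<otimes> snd x))"
      by (intro continuous_map_pairedI continuous_map_fst G.continuous_map_mult_of G.continuous_map_inv_of
          continuous_map_comp[OF continuous_map_fst \<kappa>c] continuous_map_into_fulltopology[OF continuous_map_snd])
    from continuous_map_comp[OF this chart_cont[OF c]]
    have "continuous_map (prod_topology (subtopology M U) TK) (total P) \<Phi>"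
      by (simp add: \<Phi>_def case_prod_unfold)
    then show "continuous_map (prod_topology (subtopology M U) TK) (total (reduction P)) \<Phi>"
      using \<Phi>mem(2) by (auto simp: reduction_def continuous_map_in_subtopology)
    let ?W = "{p \<in> topspace (total (reduction P)). bproj (reduction P) p \<in> U}"
    have W: "?W = {p \<in> topspace (total P). bproj P p \<in> U} \<inter> ?R"
      by (auto simp: reduction_def)
    have sub: "subtopology (total (reduction P)) ?W =
        subtopology (subtopology (total P) {p \<in> topspace (total P). bproj P p \<in> U}) ?R"
      unfolding W by (simp add: reduction_def subtopology_subtopology Int_ac)
    have "continuous_map (subtopology (total P) {p \<in> topspace (total P). bproj P p \<in> U}) (subtopology M U) (bproj P)"
      using G.bproj_cont[OF prin] by (auto simp: continuous_map_in_subtopology continuous_map_from_subtopology)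
    from G.continuous_map_mult_of[OF continuous_map_comp[OF this \<kappa>c] chart_coord_cont[OF c]]
    have "continuous_map (subtopology (total (reduction P)) ?W) TG \<T>"
      unfolding sub \<T>_def by (rule continuous_map_from_subtopology)
    then show "continuous_map (subtopology (total (reduction P)) ?W) TK \<T>"
      using \<T>mem by (auto simp: continuous_map_in_subtopology W)
    show "bproj (reduction P) (\<Phi> (u, a)) = u" "\<T> (\<Phi> (u, a)) = a" if "u \<in> U" "a \<in> carrier K" for u a
    proof -
      have a: "inv (\<kappa> u) \<otimes> a \<in> carrier G" "a \<in> carrier G" using that kernel_closed \<kappa>G by auto
      show "bproj (reduction P) (\<Phi> (u, a)) = u"
        using chart_proj[OF c that(1) a(1)] by (simp add: reduction_def \<Phi>_def)
      show "\<T> (\<Phi> (u, a)) = a"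
        using chart_proj[OF c that(1) a(1)] chart_coord[OF c that(1) a(1)] \<kappa>G[OF that(1)] a
        by (simp add: \<T>_def \<Phi>_def inv_mult_cancel)
    qed
    show "\<Phi> (bproj (reduction P) p, \<T> p) = p"
      if "p \<in> topspace (total (reduction P))" "bproj (reduction P) p \<in> U" for p
      using that chart_inverse[OF c, of p] \<tau>G[of p] \<kappa>G[of "bproj P p"]
      by (simp add: reduction_def \<Phi>_def \<T>_def inv_mult_cancel)
    show "\<Phi> (u, a \<otimes>\<^bsub>K\<^esub> b) = ract (reduction P) (\<Phi> (u, a)) b"
      if "u \<in> U" "a \<in> carrier K" "b \<in> carrier K" for u a b
      using that kernel_closed[of a] kernel_closed[of b] \<kappa>G[of u] chart_mult[OF c, of u "inv (\<kappa> u) \<otimes> a" b]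
      by (simp add: \<Phi>_def reduction_def G.m_assoc)
  qed
  then show "\<exists>U \<phi> \<tau>. m \<in> U \<and> bundle_chart K TK M (reduction P) U \<phi> \<tau>" using mU by blast
qed

lemma type_map_one_iff_iota:
  fixes P :: "('p, 'm, 'g, 'h) bibundle"
  assumes P: "bibundle G TG H TH t M P"
  shows "type_map G H t M P = const_one M (H Mod (t ` carrier G)) \<longleftrightarrow>
    (\<exists>R :: ('m \<times> 'g, 'm, 'g) pbundle. principal_bundle K TK M R \<and> bibundle_isomorphic G P (iota G TG G1 t R))"
proof
  assume "type_map G H t M P = const_one M (H Mod (t ` carrier G))"
  then have "\<And>p. p \<in> topspace (total P) \<Longrightarrow> str P p \<in> t ` carrier G"
    using type_map_eq_one_iff[OF P] by blast
  then have red: "principal_bundle K TK M (reduction P)" by (rule reduction_principal[OF P])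
  \<comment> \<open>The reduction has the type of \<open>P\<close>; the witness is required on
    \<open>'m \<times> 'g\<close>, so an isomorphic copy is taken.\<close>
  then obtain R :: "('m \<times> 'g, 'm, 'g) pbundle"
    where R: "principal_bundle K TK M R" "bundle_isomorphic K (reduction P) R"
    using bundle_representable[OF K.is_group K.topspace_eq] by blast
  \<comment> \<open>The reduction is the locus of structure value 1, so its inclusion into
    \<open>P\<close> meets the conditions of \<open>iota_isomorphicI\<close>.\<close>
  have "bibundle_isomorphic G (iota G TG G1 t (reduction P)) P"
  proof (rule iota_isomorphicI[OF red P, where j = "\<lambda>p. p"])
    show "continuous_map (total (reduction P)) (total P) (\<lambda>p. p)"
      using continuous_map_from_subtopology[OF continuous_map_id[of "total P"]]
      by (simp add: reduction_def id_def)
  qed (simp_all add: reduction_def)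
  then have "bibundle_isomorphic G P (iota G TG G1 t (reduction P))"
    by (rule G.bibundle_isomorphic_sym[OF iota_bibundle[OF red]])
  then have "bibundle_isomorphic G P (iota G TG G1 t R)"
    using iota_isomorphic[OF red R] by (rule bibundle_isomorphic_trans)
  then show "\<exists>R :: ('m \<times> 'g, 'm, 'g) pbundle.
      principal_bundle K TK M R \<and> bibundle_isomorphic G P (iota G TG G1 t R)"
    using R by blast
next
  assume "\<exists>R :: ('m \<times> 'g, 'm, 'g) pbundle.
      principal_bundle K TK M R \<and> bibundle_isomorphic G P (iota G TG G1 t R)"
  then obtain R :: "('m \<times> 'g, 'm, 'g) pbundle"
    where R: "principal_bundle K TK M R" "bibundle_isomorphic G P (iota G TG G1 t R)" by blast
  then show "type_map G H t M P = const_one M (H Mod (t ` carrier G))"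
    using type_map_isomorphic[OF P iota_bibundle[OF R(1)] R(2)] type_map_iota[OF R(1)] by simp
qed

section \<open>The sequence on isomorphism classes\<close>

lemma pi0_iota_class:
  fixes Q :: "('m \<times> 'g, 'm, 'g) pbundle"
  assumes Q: "principal_bundle K TK M Q"
  shows "pi0_iota G TG G1 H TH t M (bundle_class K TK M Q) = bibundle_class G TG H TH t M (iota G TG G1 t Q)"
proof -
  \<comment> \<open>\<open>pi0_iota\<close> is a union over all members of the class. As
    \<open>iota\<close> preserves isomorphism, every member contributes the same set and the union
    collapses.\<close>
  have "bibundle_class G TG H TH t M (iota G TG G1 t Q') = bibundle_class G TG H TH t M (iota G TG G1 t Q)"
    if "Q' \<in> bundle_class K TK M Q" for Q'
  proof -
    have Q': "principal_bundle K TK M Q'" "bundle_isomorphic K Q' Q"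
      using that by (auto simp: bundle_class_def)
    then show ?thesis
      using G.bibundle_class_eq_iff[OF iota_bibundle[OF Q'(1)] iota_bibundle[OF Q]]
        iota_isomorphic[OF Q'(1) Q Q'(2)] by blast
  qed
  moreover have "Q \<in> bundle_class K TK M Q"
    using Q K.bundle_class_eq_iff[OF Q Q] by (simp add: bundle_class_def)
  ultimately show ?thesis unfolding pi0_iota_def by blast
qed

text \<open>The type is an isomorphism invariant, so its image of a class is a singleton.\<close>

lemma pi0_type_class:
  fixes P :: "('m \<times> 'g, 'm, 'g, 'h) bibundle"
  assumes P: "bibundle G TG H TH t M P"
  shows "pi0_type G H t M (bibundle_class G TG H TH t M P) = type_map G H t M P"
  unfolding pi0_type_def
proof (rule the_elem_image_unique)
  have "P \<in> bibundle_class G TG H TH t M P"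
    using P G.bibundle_class_eq_iff[OF P P] by (simp add: bibundle_class_def)
  then show "bibundle_class G TG H TH t M P \<noteq> {}" by blast
  show "type_map G H t M P' = type_map G H t M P" if "P' \<in> bibundle_class G TG H TH t M P" for P'
    using that type_map_isomorphic[of M P' P] P by (simp add: bibundle_class_def)
qed

lemma pi0_iota_trivial:
  "pi0_iota G TG G1 H TH t M (snd (pi0_Bun K TK M)) = snd (pi0_Bibun G TG H TH t M)"
  unfolding pi0_Bun_def pi0_Bibun_def snd_conv pi0_iota_class[OF K.trivial_bundle_principal]
  using G.bibundle_class_eq_iff[OF iota_bibundle[OF K.trivial_bundle_principal] trivial_bibundle_bibundle]
    iota_trivial by blast

lemma pointed_map_iota:
  fixes M :: "'m topology"
  shows "pointed_map (pi0_Bun K TK M) (pi0_Bibun G TG H TH t M) (pi0_iota G TG G1 H TH t M)"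
  unfolding pointed_map_def
proof (intro conjI)
  show "snd (pi0_Bun K TK M) \<in> fst (pi0_Bun K TK M)"
    using K.trivial_bundle_principal by (auto simp: pi0_Bun_def)
  show "snd (pi0_Bibun G TG H TH t M) \<in> fst (pi0_Bibun G TG H TH t M)"
    using trivial_bibundle_bibundle by (auto simp: pi0_Bibun_def)
  show "pi0_iota G TG G1 H TH t M \<in> fst (pi0_Bun K TK M) \<rightarrow> fst (pi0_Bibun G TG H TH t M)"
  proof
    fix c assume "c \<in> fst (pi0_Bun K TK M)"
    then obtain Q :: "('m \<times> 'g, 'm, 'g) pbundle"
      where Q: "principal_bundle K TK M Q" "c = bundle_class K TK M Q"
      by (auto simp: pi0_Bun_def)
    then show "pi0_iota G TG G1 H TH t M c \<in> fst (pi0_Bibun G TG H TH t M)"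
      using G.bibundle_class_mem_pi0[OF iota_bibundle[OF Q(1)]] by (simp add: pi0_iota_class)
  qed
qed (rule pi0_iota_trivial)

text \<open>For pointed sets, exactness at this place concerns only the fibre of
  \<open>pi0_iota\<close> over the base point and does not assert injectivity; hence
  \<open>iota_reflects_trivial\<close> is the form required.\<close>

lemma exact_at_Bun:
  fixes M :: "'m topology"
  shows "exact_at one_pointed (\<lambda>_. snd (pi0_Bun K TK M)) (pi0_Bun K TK M)
     (pi0_iota G TG G1 H TH t M) (pi0_Bibun G TG H TH t M)"
  unfolding exact_at_def
proof (intro conjI pointed_map_iota)
  show "pointed_map one_pointed (pi0_Bun K TK M) (\<lambda>_. snd (pi0_Bun K TK M))"
    using pointed_map_iota[of M] by (simp add: pointed_map_def one_pointed_def)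
  show "(\<lambda>_. snd (pi0_Bun K TK M)) ` fst one_pointed =
      {c \<in> fst (pi0_Bun K TK M). pi0_iota G TG G1 H TH t M c = snd (pi0_Bibun G TG H TH t M)}"
  proof (intro subset_antisym subsetI)
    fix c assume "c \<in> (\<lambda>_. snd (pi0_Bun K TK M)) ` fst one_pointed"
    then show "c \<in> {c \<in> fst (pi0_Bun K TK M). pi0_iota G TG G1 H TH t M c = snd (pi0_Bibun G TG H TH t M)}"
      using pointed_map_iota[of M] by (auto simp: pointed_map_def)
  next
    fix c
    assume "c \<in> {c \<in> fst (pi0_Bun K TK M). pi0_iota G TG G1 H TH t M c = snd (pi0_Bibun G TG H TH t M)}"
    then obtain Q :: "('m \<times> 'g, 'm, 'g) pbundle"
      where Q: "principal_bundle K TK M Q" "c = bundle_class K TK M Q"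
        and "pi0_iota G TG G1 H TH t M c = snd (pi0_Bibun G TG H TH t M)"
      by (auto simp: pi0_Bun_def)
    then have "bibundle_class G TG H TH t M (iota G TG G1 t Q) =
        bibundle_class G TG H TH t M (trivial_bibundle G TG t M)"
      by (simp add: pi0_iota_class pi0_Bibun_def)
    then have "bundle_isomorphic K Q (trivial_bundle K TK M)"
      using G.bibundle_class_eq_iff[OF iota_bibundle[OF Q(1)] trivial_bibundle_bibundle]
        iota_reflects_trivial[OF Q(1)] by blast
    then have "c = snd (pi0_Bun K TK M)"
      using K.bundle_class_eq_iff[OF Q(1) K.trivial_bundle_principal] Q(2) by (simp add: pi0_Bun_def)
    then show "c \<in> (\<lambda>_. snd (pi0_Bun K TK M)) ` fst one_pointed" by (simp add: one_pointed_def)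
  qed
qed

lemma pointed_map_type:
  fixes M :: "'m topology"
  shows "pointed_map (pi0_Bibun G TG H TH t M)
     (Map_pointed M (H Mod (t ` carrier G)) (coset_topology H TH (t ` carrier G))) (pi0_type G H t M)"
  unfolding pointed_map_def
proof (intro conjI)
  let ?C = "Map_pointed M (H Mod (t ` carrier G)) (coset_topology H TH (t ` carrier G))"
  have type_mem: "type_map G H t M P \<in> fst ?C" if "bibundle G TG H TH t M P"
    for P :: "('m \<times> 'g, 'm, 'g, 'h) bibundle"
    using type_map_extensional[OF that] type_map_continuous[OF that] by (simp add: Map_pointed_def)
  show "snd (pi0_Bibun G TG H TH t M) \<in> fst (pi0_Bibun G TG H TH t M)"
    using trivial_bibundle_bibundle by (auto simp: pi0_Bibun_def)
  show "pi0_type G H t M \<in> fst (pi0_Bibun G TG H TH t M) \<rightarrow> fst ?C"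
    using type_mem by (auto simp: pi0_Bibun_def pi0_type_class)
  have "type_map G H t M (trivial_bibundle G TG t M) = snd ?C"
    using type_map_isomorphic[OF iota_bibundle[OF K.trivial_bundle_principal[of M]] trivial_bibundle_bibundle iota_trivial]
      type_map_iota[OF K.trivial_bundle_principal[of M]] by (simp add: Map_pointed_def)
  then show "pi0_type G H t M (snd (pi0_Bibun G TG H TH t M)) = snd ?C"
    by (simp add: pi0_Bibun_def pi0_type_class[OF trivial_bibundle_bibundle])
  \<comment> \<open>The constant map is the type of the trivial bibundle, so its continuity is an
    instance of \<open>type_map_continuous\<close>.\<close>
  then show "snd ?C \<in> fst ?C"
    using type_mem[OF trivial_bibundle_bibundle] \<open>type_map G H t M (trivial_bibundle G TG t M) = snd ?C\<close> by simp
qed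

lemma exact_at_Bibun:
  fixes M :: "'m topology"
  shows "exact_at (pi0_Bun K TK M) (pi0_iota G TG G1 H TH t M) (pi0_Bibun G TG H TH t M) (pi0_type G H t M)
     (Map_pointed M (H Mod (t ` carrier G)) (coset_topology H TH (t ` carrier G)))"
  unfolding exact_at_def
proof (intro conjI pointed_map_iota pointed_map_type)
  let ?C = "Map_pointed M (H Mod (t ` carrier G)) (coset_topology H TH (t ` carrier G))"
  \<comment> \<open>Testing a class on a representative reduces exactness to
    \<open>type_map_one_iff_iota\<close>.\<close>
  have key: "bibundle_class G TG H TH t M P \<in> pi0_iota G TG G1 H TH t M ` fst (pi0_Bun K TK M) \<longleftrightarrow>
      type_map G H t M P = snd ?C"
    if P: "bibundle G TG H TH t M P" for P :: "('m \<times> 'g, 'm, 'g, 'h) bibundle"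
  proof -
    have "bibundle_class G TG H TH t M P \<in> pi0_iota G TG G1 H TH t M ` fst (pi0_Bun K TK M) \<longleftrightarrow>
        (\<exists>R :: ('m \<times> 'g, 'm, 'g) pbundle. principal_bundle K TK M R \<and>
          bibundle_class G TG H TH t M P = bibundle_class G TG H TH t M (iota G TG G1 t R))"
      by (auto simp: pi0_Bun_def pi0_iota_class image_iff)
    also have "\<dots> \<longleftrightarrow> (\<exists>R :: ('m \<times> 'g, 'm, 'g) pbundle. principal_bundle K TK M R \<and>
          bibundle_isomorphic G P (iota G TG G1 t R))"
      using G.bibundle_class_eq_iff[OF P iota_bibundle] by blast
    finally show ?thesis using type_map_one_iff_iota[OF P] by (simp add: Map_pointed_def)
  qed
  show "pi0_iota G TG G1 H TH t M ` fst (pi0_Bun K TK M) =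
      {c \<in> fst (pi0_Bibun G TG H TH t M). pi0_type G H t M c = snd ?C}"
  proof (rule Set.set_eqI)
    fix c
    show "c \<in> pi0_iota G TG G1 H TH t M ` fst (pi0_Bun K TK M) \<longleftrightarrow>
        c \<in> {c \<in> fst (pi0_Bibun G TG H TH t M). pi0_type G H t M c = snd ?C}"
    proof (cases "c \<in> fst (pi0_Bibun G TG H TH t M)")
      case True
      then obtain P :: "('m \<times> 'g, 'm, 'g, 'h) bibundle"
        where P: "bibundle G TG H TH t M P" "c = bibundle_class G TG H TH t M P"
        by (auto simp: pi0_Bibun_def)
      then show ?thesis using True key[OF P(1)] by (simp add: pi0_type_class)
    next
      case False
      then show ?thesis using pointed_map_iota[of M] by (auto simp: pointed_map_def)
    qed
  qed
qed

end

text \<open>\<open>TopAut\<close> keeps the unit of \<open>AutoGroup\<close>, the extensional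
  identity of the carrier; conjugation by \<open>z\<close> equals it exactly when \<open>z\<close>
  commutes with every element.\<close>

lemma (in group) kernel_Ad: "kernel G (TopAut G T) (Ad G) = group_center G"
proof -
  have "Ad G z = \<one>\<^bsub>TopAut G T\<^esub> \<longleftrightarrow> (\<forall>x \<in> carrier G. z \<otimes> x = x \<otimes> z)" if z: "z \<in> carrier G" for z
  proof -
    have one: "\<one>\<^bsub>TopAut G T\<^esub> = (\<lambda>x \<in> carrier G. x)"
      by (simp add: TopAut_def AutoGroup_def BijGroup_def)
    have "Ad G z = \<one>\<^bsub>TopAut G T\<^esub> \<longleftrightarrow> (\<forall>x \<in> carrier G. z \<otimes> x \<otimes> inv z = x)"
      unfolding one Ad_def by (auto simp: restrict_def fun_eq_iff)
    also have "\<dots> \<longleftrightarrow> (\<forall>x \<in> carrier G. z \<otimes> x = x \<otimes> z)"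
      using z inv_solve_right' by (intro ball_cong) (auto simp: inv_solve_right')
    finally show ?thesis .
  qed
  then show ?thesis by (auto simp: kernel_def group_center_def)
qed

theorem mainTheorem1:
  fixes G :: "('g, 'x) monoid_scheme" and TG :: "'g topology"
    and H :: "('h, 'y) monoid_scheme" and TH :: "'h topology"
    and t :: "'g \<Rightarrow> 'h" and \<alpha> :: "'h \<Rightarrow> 'g \<Rightarrow> 'g"
    and M :: "'m topology"
  shows
    "(admissible_crossed_module G TG H TH t \<alpha> \<longrightarrow>
       (let G1 = kernel G H t; K = G\<lparr>carrier := G1\<rparr>; TK = subtopology TG G1;
            N = t ` carrier G
        in
          exact_at
            one_pointed
            (\<lambda>_. snd (pi0_Bun K TK M))
            (pi0_Bun K TK M)
            (pi0_iota G TG G1 H TH t M)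
            (pi0_Bibun G TG H TH t M) \<and>
          exact_at
            (pi0_Bun K TK M)
            (pi0_iota G TG G1 H TH t M)
            (pi0_Bibun G TG H TH t M)
            (pi0_type G H t M)
            (Map_pointed M (H Mod N) (coset_topology H TH N)) \<and>
          (\<forall>Q :: ('q, 'm, 'g) pbundle.
             principal_bundle K TK M Q \<longrightarrow>
             bibundle_isomorphic G (iota G TG G1 t Q) (trivial_bibundle G TG t M) \<longrightarrow>
             bundle_isomorphic K Q (trivial_bundle K TK M)) \<and>
          (\<forall>P :: ('p, 'm, 'g, 'h) bibundle.
             bibundle G TG H TH t M P \<longrightarrow>
             (type_map G H t M P = const_one M (H Mod N) \<longleftrightarrow>
              (\<exists>R :: ('m \<times> 'g, 'm, 'g) pbundle.
                 principal_bundle K TK M R \<and> bibundle_isomorphic G P (iota G TG G1 t R)))))) \<and>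
     (\<forall>TA. admissible_crossed_module G TG (TopAut G TG) TA (Ad G) (\<lambda>f. f) \<longrightarrow>
       (let Z = group_center G; K = G\<lparr>carrier := Z\<rparr>; TK = subtopology TG Z
        in
          exact_at
            (pi0_Bun K TK M)
            (pi0_iota G TG Z (TopAut G TG) TA (Ad G) M)
            (pi0_Bibun G TG (TopAut G TG) TA (Ad G) M)
            (pi0_type G (TopAut G TG) (Ad G) M)
            (Map_pointed M (Out G TG) (coset_topology (TopAut G TG) TA (Inn G)))))"
proof (intro conjI allI impI)
  assume "admissible_crossed_module G TG H TH t \<alpha>"
  then interpret admissible_crossed_module G TG H TH t \<alpha> .
  show "let G1 = kernel G H t; K = G\<lparr>carrier := G1\<rparr>; TK = subtopology TG G1;
            N = t ` carrier G
        in
          exact_at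
            one_pointed
            (\<lambda>_. snd (pi0_Bun K TK M))
            (pi0_Bun K TK M)
            (pi0_iota G TG G1 H TH t M)
            (pi0_Bibun G TG H TH t M) \<and>
          exact_at
            (pi0_Bun K TK M)
            (pi0_iota G TG G1 H TH t M)
            (pi0_Bibun G TG H TH t M)
            (pi0_type G H t M)
            (Map_pointed M (H Mod N) (coset_topology H TH N)) \<and>
          (\<forall>Q :: ('q, 'm, 'g) pbundle.
             principal_bundle K TK M Q \<longrightarrow>
             bibundle_isomorphic G (iota G TG G1 t Q) (trivial_bibundle G TG t M) \<longrightarrow>
             bundle_isomorphic K Q (trivial_bundle K TK M)) \<and>
          (\<forall>P :: ('p, 'm, 'g, 'h) bibundle.
             bibundle G TG H TH t M P \<longrightarrow>
             (type_map G H t M P = const_one M (H Mod N) \<longleftrightarrow>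
              (\<exists>R :: ('m \<times> 'g, 'm, 'g) pbundle.
                 principal_bundle K TK M R \<and> bibundle_isomorphic G P (iota G TG G1 t R))))"
    unfolding Let_def
    by (intro conjI allI impI exact_at_Bun exact_at_Bibun iota_reflects_trivial type_map_one_iff_iota)
next
  fix TA assume "admissible_crossed_module G TG (TopAut G TG) TA (Ad G) (\<lambda>f. f)"
  then interpret admissible_crossed_module G TG "TopAut G TG" TA "Ad G" "\<lambda>f. f" .
  show "let Z = group_center G; K = G\<lparr>carrier := Z\<rparr>; TK = subtopology TG Z
        in
          exact_at
            (pi0_Bun K TK M)
            (pi0_iota G TG Z (TopAut G TG) TA (Ad G) M)
            (pi0_Bibun G TG (TopAut G TG) TA (Ad G) M)
            (pi0_type G (TopAut G TG) (Ad G) M)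
            (Map_pointed M (Out G TG) (coset_topology (TopAut G TG) TA (Inn G)))"
    \<comment> \<open>For \<open>t = Ad G\<close> the kernel is the centre and the image is
      \<open>Inn G\<close>, so the general exactness becomes the goal once both are renamed.\<close>
    using exact_at_Bibun[of M] unfolding Let_def G.kernel_Ad Out_def .
qed

end
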